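(* Let $\mathcal Q$ be a $\sigma$-ring, $\mathbb K$ be a topological field, and $\mathfrak A$ be a Hausdorff topological $\mathbb K$-vector space. Then $\mathcal M(\mathcal Q,\mathfrak A)$ is a $\mathbb K$-vector space. If $k\in\mathbb K$ is nonzero, then $k\mu=k\cdot\mu$ for every $\mu\in\mathcal M(\mathcal Q,\mathfrak A)$. If $\mathfrak B$ is a sequentially closed topological vector subspace of $\mathfrak A$, then $\mathcal M(\mathcal Q,\mathfrak B)$ is a $\mathbb K$-vector subspace of $\mathcal M(\mathcal Q,\mathfrak A)$.
   Context: Monoids and groups are Abelian and written additively. An HTM is a monoid with a Hausdorff topology making addition continuous. For a map $f$, $D_f$ denotes its domain. "Countable" includes finite and empty. A subset is sequentially closed if it contains every limit of a convergent sequence of its elements. A ring (of sets) is a nonempty set $\mathcal Q$ of sets such that $A\cup B\in\mathcal Q$ and $A\setminus B\in\mathcal Q$ for all $A,B\in\mathcal Q$. A $\delta$-ring is a ring closed under intersections of nonempty countable families; a $\sigma$-ring is a ring closed under countable unions. For a set of sets $\mathcal K$, $\sigma(\mathcal K)$ is the smallest $\sigma$-ring containing $\mathcal K$. A family $\mathbf A\colon I\to\mathcal Q$ is a partition of $A$ (into elements of $\mathcal Q$) if $\mathbf A(i)\cap\mathbf A(j)=\varnothing$ for $i\ne j$ and $\bigcup_{i\in I}\mathbf A(i)=A$ (members may be empty and $I$ may be empty); it is countable if $I$ is countable. A family $f\colon I\to\mathfrak A$ in an HTM is summable in $\mathfrak A$ if the net $J\mapsto\sum_{i\in J}f(i)$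 over the finite subsets $J\subset I$, directed by inclusion, converges in $\mathfrak A$; its limit is denoted $\sum f$. An $\mathfrak A$-valued premeasure is a map $\mu\colon D_\mu\to\mathfrak A$ whose domain $D_\mu$ is a $\delta$-ring and such that for every $A\in D_\mu$ and every countable partition $\mathbf A$ of $A$ into elements of $D_\mu$, the family $\mu\circ\mathbf A$ is summable in $\mathfrak A$ and $\mu(A)=\sum\mu\circ\mathbf A$. The host $\sigma$-ring of a map $\mu$ is $\mathscr H[\mu]=\sigma(D_\mu)$. Maps $\mu,\nu$ are similar, $\mu\asymp\nu$, if $\mathscr H[\mu]=\mathscr H[\nu]$ and $\mu,\nu$ coincide on $D_\mu\cap D_\nu$. An $\mathfrak A$-valued measure is an $\mathfrak A$-valued premeasure $\mu$ which is an extension of every $\mathfrak A$-valued premeasure $\nu$ with $\nu\asymp\mu$. For every $\mathfrak A$-valued premeasure $\mu$ there is a unique $\mathfrak A$-valued measure similar to $\mu$; it is called the measure associated with $\mu$ and denoted $[\![\mu]\!]_{\mathfrak A}$. $\mathcal M(\mathcal Q,\mathfrak A)$ is the set of all $\mathfrak A$-valued measures $\mu$ with $\mathscr H[\mu]=\mathcal Q$, endowed with the addition $\mu+\nu=[\![\mu\dotplus\nu]\!]_{\mathfrak A}$, where $\mu\dotplus\nu$ is the pointwise sum defined on $D_\mu\cap D_\nu$, and with the scalar multiplication $k\mu=[\![k\cdot\mu]\!]_{\mathfrak A}$, where $k\cdot\mu$ is the pointwise multiple $A\mapsto k\mu(A)$ on $D_\mu$ (both $\mu\dotplus\nu$ and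 $k\cdot\mu$ are $\mathfrak A$-valued premeasures with host $\sigma$-ring $\mathcal Q$). $\mathcal M(\mathcal Q,\mathfrak B)$ is defined in the same way from $\mathfrak B$ with the induced topology and operations; being a subspace of $\mathcal M(\mathcal Q,\mathfrak A)$ means being contained in it as a set, with vector space structure induced from it. *)

theory Defs
  imports "HOL-Analysis.Analysis" "HOL-Algebra.Module"
begin

text \<open>The Hausdorff property is not part of the definition of a topological field.\<close>

class topological_field = field + topological_ab_group_add + topological_semigroup_mult +
  assumes tendsto_inverse_nonzero:
    "x \<noteq> 0 \<Longrightarrow> (inverse \<longlongrightarrow> inverse x) (at x within - {0})"

lemma continuous_on_inverse_nonzero:
  "continuous_on (- {0}) (inverse :: 'k::topological_field \<Rightarrow> 'k)"
  by (simp add: continuous_on_def tendsto_inverse_nonzero)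

locale topological_vector_space = vector_space smul
  for smul :: "'k::topological_field \<Rightarrow> 'a::topological_ab_group_add \<Rightarrow> 'a" +
  assumes continuous_on_scale: "continuous_on UNIV (\<lambda>(k, x). smul k x)"

definition seq_closed :: "'a::topological_space set \<Rightarrow> bool" where
  "seq_closed S \<longleftrightarrow> (\<forall>x l. (\<forall>n. x n \<in> S) \<and> x \<longlonglongrightarrow> l \<longrightarrow> l \<in> S)"

definition set_ring :: "'x set set \<Rightarrow> bool" where
  "set_ring \<Q> \<longleftrightarrow> \<Q> \<noteq> {} \<and> (\<forall>A\<in>\<Q>. \<forall>B\<in>\<Q>. A \<union> B \<in> \<Q> \<and> A - B \<in> \<Q>)"

definition delta_ring :: "'x set set \<Rightarrow> bool" where
  "delta_ring \<Q> \<longleftrightarrow> set_ring \<Q> \<and> (\<forall>\<C>. \<C> \<subseteq> \<Q> \<and> countable \<C> \<and> \<C> \<noteq> {} \<longrightarrow> \<Inter>\<C> \<in> \<Q>)"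

definition sigma_ring :: "'x set set \<Rightarrow> bool" where
  "sigma_ring \<Q> \<longleftrightarrow> set_ring \<Q> \<and> (\<forall>\<C>. \<C> \<subseteq> \<Q> \<and> countable \<C> \<longrightarrow> \<Union>\<C> \<in> \<Q>)"

lemma set_ring_iff_ring_of_sets: "set_ring \<Q> \<longleftrightarrow> ring_of_sets UNIV \<Q>"
proof
  assume *: "set_ring \<Q>"
  then obtain A where "A \<in> \<Q>" by (auto simp: set_ring_def)
  with * have "A - A \<in> \<Q>" unfolding set_ring_def by blast
  with * show "ring_of_sets UNIV \<Q>" by (auto simp: set_ring_def ring_of_sets_iff)
qed (auto simp: set_ring_def ring_of_sets_iff)

lemma sigma_ring_hull: "sigma_ring (sigma_ring hull \<K>)"
proof (rule hull_in)
  fix T :: "'a set set set"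
  assume T: "Ball T sigma_ring"
  have "{} \<in> \<Q>" if "\<Q> \<in> T" for \<Q>
    using T that by (fastforce simp: sigma_ring_def)
  then have "\<Inter>T \<noteq> {}" by blast
  moreover have "A \<union> B \<in> \<Inter>T \<and> A - B \<in> \<Inter>T" if "A \<in> \<Inter>T" "B \<in> \<Inter>T" for A B
    using T that by (auto simp: sigma_ring_def set_ring_def)
  moreover have "\<Union>\<C> \<in> \<Inter>T" if "\<C> \<subseteq> \<Inter>T" "countable \<C>" for \<C>
  proof
    fix \<Q> assume "\<Q> \<in> T"
    then have "\<C> \<subseteq> \<Q>" "sigma_ring \<Q>" using T that(1) by auto
    then show "\<Union>\<C> \<in> \<Q>" using that(2) by (simp add: sigma_ring_def)
  qed
  ultimately show "sigma_ring (\<Inter>T)" by (auto simp: sigma_ring_def set_ring_def)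
qed

text \<open>
  The value monoid is given by a topology \<open>T\<close> on (a subset of) a type; its underlying set is
  \<open>topspace T\<close>. Thus \<open>T = euclidean\<close> is the whole type, and \<open>T = top_of_set B\<close> is the subset
  \<open>B\<close> with the induced topology. In the latter case convergence means convergence to a point
  of \<open>B\<close>.

  A map \<open>\<mu>\<close> together with its domain is a partial function on sets, with \<open>D\<^sub>\<mu> = dom \<mu>\<close>.
\<close>

definition has_sum_in ::
  "'a::comm_monoid_add topology \<Rightarrow> ('i \<Rightarrow> 'a) \<Rightarrow> 'i set \<Rightarrow> 'a \<Rightarrow> bool" where
  "has_sum_in T f I s \<longleftrightarrow> limitin T (\<lambda>J. \<Sum>i\<in>J. f i) s (finite_subsets_at_top I)"

lemma has_sum_in_euclidean: "has_sum_in euclidean f I s \<longleftrightarrow> (f has_sum s) I"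
  by (simp add: has_sum_in_def has_sum_def)

definition partition_into :: "'x set set \<Rightarrow> 'i set \<Rightarrow> ('i \<Rightarrow> 'x set) \<Rightarrow> 'x set \<Rightarrow> bool" where
  "partition_into \<Q> I F A \<longleftrightarrow> F ` I \<subseteq> \<Q> \<and> disjoint_family_on F I \<and> (\<Union>i\<in>I. F i) = A"

text \<open>
  The index sets of countable families are taken to be arbitrary subsets of \<open>nat\<close> (finite,
  empty or infinite); up to reindexing these are all countable index sets.
\<close>

definition premeasure ::
  "'a::comm_monoid_add topology \<Rightarrow> ('x set \<rightharpoonup> 'a) \<Rightarrow> bool" where
  "premeasure T \<mu> \<longleftrightarrow>
     ran \<mu> \<subseteq> topspace T \<and> delta_ring (dom \<mu>) \<and>
     (\<forall>A\<in>dom \<mu>. \<forall>(I::nat set) F. partition_into (dom \<mu>) I F A \<longrightarrow>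
        has_sum_in T (\<lambda>i. the (\<mu> (F i))) I (the (\<mu> A)))"

definition host :: "('x set \<rightharpoonup> 'a) \<Rightarrow> 'x set set" where
  "host \<mu> = sigma_ring hull (dom \<mu>)"

definition similar :: "('x set \<rightharpoonup> 'a) \<Rightarrow> ('x set \<rightharpoonup> 'a) \<Rightarrow> bool" where
  "similar \<mu> \<nu> \<longleftrightarrow> host \<mu> = host \<nu> \<and> (\<forall>A \<in> dom \<mu> \<inter> dom \<nu>. \<mu> A = \<nu> A)"

definition valued_measure ::
  "'a::comm_monoid_add topology \<Rightarrow> ('x set \<rightharpoonup> 'a) \<Rightarrow> bool" where
  "valued_measure T \<mu> \<longleftrightarrow>
     premeasure T \<mu> \<and> (\<forall>\<nu>. premeasure T \<nu> \<and> similar \<nu> \<mu> \<longrightarrow> \<nu> \<subseteq>\<^sub>m \<mu>)"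

definition assoc_measure ::
  "'a::comm_monoid_add topology \<Rightarrow> ('x set \<rightharpoonup> 'a) \<Rightarrow> ('x set \<rightharpoonup> 'a)" where
  "assoc_measure T \<mu> = (THE \<nu>. valued_measure T \<nu> \<and> similar \<nu> \<mu>)"

definition pointwise_sum ::
  "('x set \<rightharpoonup> 'a::plus) \<Rightarrow> ('x set \<rightharpoonup> 'a) \<Rightarrow> ('x set \<rightharpoonup> 'a)" where
  "pointwise_sum \<mu> \<nu> =
     (\<lambda>A. if A \<in> dom \<mu> \<inter> dom \<nu> then Some (the (\<mu> A) + the (\<nu> A)) else None)"

definition pointwise_scale ::
  "('k \<Rightarrow> 'a \<Rightarrow> 'a) \<Rightarrow> 'k \<Rightarrow> ('x set \<rightharpoonup> 'a) \<Rightarrow> ('x set \<rightharpoonup> 'a)" where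
  "pointwise_scale smul k \<mu> = (\<lambda>A. map_option (smul k) (\<mu> A))"

text \<open>
  The neutral element is the zero map with domain \<open>\<Q>\<close>. The record type is an extension of the
  ring record, so it has two multiplicative fields, which play no role for modules.
\<close>

definition measure_space_over ::
  "('k \<Rightarrow> 'a \<Rightarrow> 'a) \<Rightarrow> 'x set set \<Rightarrow> 'a::comm_monoid_add topology \<Rightarrow> ('k, 'x set \<rightharpoonup> 'a) module"
  where
  "measure_space_over smul \<Q> T =
    \<lparr> carrier = {\<mu>. valued_measure T \<mu> \<and> host \<mu> = \<Q>},
      mult = undefined,
      one = undefined,
      zero = (\<lambda>A. if A \<in> \<Q> then Some 0 else None),
      add = (\<lambda>\<mu> \<nu>. assoc_measure T (pointwise_sum \<mu> \<nu>)),
      smult = (\<lambda>k \<mu>. assoc_measure T (pointwise_scale smul k \<mu>)) \<rparr>"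

definition field_record :: "'k::field ring" where
  "field_record = \<lparr> carrier = UNIV, mult = (*), one = 1, zero = 0, add = (+) \<rparr>"

definition vector_space_over :: "('k, 'm) ring_scheme \<Rightarrow> ('k, 'v, 'n) module_scheme \<Rightarrow> bool" where
  "vector_space_over K V \<longleftrightarrow> Ring.field K \<and> Module.module K V"

text \<open>\<open>W\<close> is a subspace of \<open>V\<close>, and its own operations are those induced from \<open>V\<close>.\<close>

definition vector_subspace_of ::
  "('k, 'm) ring_scheme \<Rightarrow> ('k, 'v, 'n) module_scheme \<Rightarrow> ('k, 'v, 'n) module_scheme \<Rightarrow> bool"
  where
  "vector_subspace_of K W V \<longleftrightarrow>
     vector_space_over K W \<and> vector_space_over K V \<and>
     submodule (carrier W) K V \<and>
     \<zero>\<^bsub>W\<^esub> = \<zero>\<^bsub>V\<^esub> \<and>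
     (\<forall>x\<in>carrier W. \<forall>y\<in>carrier W. x \<oplus>\<^bsub>W\<^esub> y = x \<oplus>\<^bsub>V\<^esub> y) \<and>
     (\<forall>k\<in>carrier K. \<forall>x\<in>carrier W. k \<odot>\<^bsub>W\<^esub> x = k \<odot>\<^bsub>V\<^esub> x)"

end

theory Submission
  imports Defs
begin

text \<open>
  The domain \<open>D\<close> of a premeasure is an ideal in its host \<open>\<Q>\<close>, and every member of \<open>\<Q>\<close> is a countable
  disjoint union of members of \<open>D\<close>; both properties are inherited by the intersection of two such
  domains. By countable additivity, premeasures with the same host that agree on such an ideal agree
  wherever both are defined. The measure associated with \<open>\<mu>\<close> lives on the sets \<open>A\<close> all of whose
  subsets in \<open>\<Q>\<close> have summable partitions into \<open>D\<close>, its values being the sums; independence of the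
  partition and countable additivity come from summing a common refinement in two ways. Since measures
  that agree on an exhausting ideal are equal, every vector space law may be checked pointwise on the
  intersection of the domains involved. Multiplication by \<open>k \<noteq> 0\<close> is invertible on premeasures, hence
  preserves maximality. A premeasure similar to a \<open>B\<close>-valued one takes values that are sums of series
  in \<open>B\<close>, so for sequentially closed \<open>B\<close> maximality among \<open>B\<close>-valued premeasures is maximality.
\<close>

section \<open>Iterated sums in topological groups\<close>

text \<open>Rows are adjoined one at a time, by additivity over disjoint index sets. It supplies the
  approximation of \<open>sum g H\<close> by finite sums of \<open>f\<close> in the iterated
  summation below.\<close>

lemma has_sum_finite_Sigma:
  fixes f :: "'b \<times> 'c \<Rightarrow> 'a :: topological_comm_monoid_add"
  assumes "finite H"
    and "\<And>x. x \<in> H \<Longrightarrow> ((\<lambda>y. f (x, y)) has_sum g x) (B x)"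
  shows "(f has_sum sum g H) (Sigma H B)"
  using assms
proof (induction H rule: finite_induct)
  case empty
  then show ?case by simp
next
  case (insert x H)
  have "(f has_sum g x) (Pair x ` B x)"
    using insert.prems[of x] by (subst has_sum_reindex) (auto simp: inj_on_def o_def)
  moreover have "(f has_sum sum g H) (Sigma H B)"
    using insert by simp
  ultimately have "(f has_sum g x + sum g H) (Pair x ` B x \<union> Sigma H B)"
    using insert.hyps by (intro has_sum_Un_disjoint) auto
  moreover have "Pair x ` B x \<union> Sigma H B = Sigma (insert x H) B"
    by auto
  ultimately show ?case
    using insert.hyps by simp
qed

text \<open>
  The library version \<open>has_sum_SigmaD\<close> assumes the class of regular Hausdorff spaces. Topological
  groups are regular, but not instances of that class.
\<close>

lemma has_sum_Sigma_group:
  fixes f :: "'b \<times> 'c \<Rightarrow> 'a :: topological_ab_group_add"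
  assumes f: "(f has_sum s) (Sigma A B)"
    and g: "\<And>x. x \<in> A \<Longrightarrow> ((\<lambda>y. f (x, y)) has_sum g x) (B x)"
  shows "(g has_sum s) A"
  unfolding has_sum_def
proof (rule topological_tendstoI)
  fix X assume X: "open X" "s \<in> X"
  \<comment> \<open>Continuity of subtraction at \<open>(s, 0)\<close> takes the place of
    regularity: it yields neighbourhoods of \<open>s\<close> and of 0 whose differences lie in
    \<open>X\<close>.\<close>
  have "((\<lambda>p. fst p - snd p) \<longlongrightarrow> s - 0) (nhds s \<times>\<^sub>F nhds 0)"
    by (intro tendsto_diff filterlim_fst filterlim_snd)
  then have "eventually (\<lambda>p. fst p - snd p \<in> X) (nhds s \<times>\<^sub>F nhds 0)"
    using X by (auto simp: tendsto_def)
  then obtain P R where P: "eventually P (nhds s)" and R: "eventually R (nhds 0)"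
    and PR: "\<And>u w. P u \<Longrightarrow> R w \<Longrightarrow> u - w \<in> X"
    by (auto simp: eventually_prod_filter)
  have "eventually (\<lambda>G. P (sum f G)) (finite_subsets_at_top (Sigma A B))"
    using f P by (auto simp: has_sum_def filterlim_iff)
  then obtain F where F: "finite F" "F \<subseteq> Sigma A B"
    and PF: "\<And>G. finite G \<Longrightarrow> F \<subseteq> G \<Longrightarrow> G \<subseteq> Sigma A B \<Longrightarrow> P (sum f G)"
    unfolding eventually_finite_subsets_at_top by metis
  \<comment> \<open>\<open>sum g H\<close> is \<open>sum f G\<close>, which is near
    \<open>s\<close>, minus the error \<open>sum f G - sum g H\<close>, which is near 0; the single
    choice \<open>G = F \<union> F'\<close> meets both demands.\<close>
  have "sum g H \<in> X" if H: "finite H" "fst ` F \<subseteq> H" "H \<subseteq> A" for H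
  proof -
    have "(f has_sum sum g H) (Sigma H B)"
      using H g by (intro has_sum_finite_Sigma) auto
    then have "((\<lambda>G. sum f G - sum g H) \<longlongrightarrow> sum g H - sum g H)
        (finite_subsets_at_top (Sigma H B))"
      unfolding has_sum_def by (intro tendsto_diff tendsto_const)
    then have "eventually (\<lambda>G. R (sum f G - sum g H)) (finite_subsets_at_top (Sigma H B))"
      using R by (simp add: filterlim_iff)
    then obtain F' where F': "finite F'" "F' \<subseteq> Sigma H B"
      and RF': "\<And>G. finite G \<Longrightarrow> F' \<subseteq> G \<Longrightarrow> G \<subseteq> Sigma H B \<Longrightarrow> R (sum f G - sum g H)"
      unfolding eventually_finite_subsets_at_top by metis
    have FH: "F \<subseteq> Sigma H B"
      using F H by force
    have "P (sum f (F \<union> F'))"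
      using F F' H by (intro PF) auto
    moreover have "R (sum f (F \<union> F') - sum g H)"
      using F F' FH by (intro RF') auto
    ultimately show ?thesis
      using PR by force
  qed
  then show "eventually (\<lambda>H. sum g H \<in> X) (finite_subsets_at_top A)"
    unfolding eventually_finite_subsets_at_top using F
    by (intro exI[of _ "fst ` F"]) auto
qed

section \<open>Delta-rings inside a sigma-ring\<close>

lemma partition_into_mem: "partition_into D I F A \<Longrightarrow> i \<in> I \<Longrightarrow> F i \<in> D"
  by (auto simp: partition_into_def)

lemma partition_into_Union: "partition_into D I F A \<Longrightarrow> (\<Union>i\<in>I. F i) = A"
  by (auto simp: partition_into_def)

lemma partition_into_inter:
  assumes "partition_into D I F A" and "\<And>i. i \<in> I \<Longrightarrow> C \<inter> F i \<in> E"
  shows "partition_into E I (\<lambda>i. C \<inter> F i) (C \<inter> A)"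
  using assms by (auto simp: partition_into_def disjoint_family_on_def disjoint_iff)

lemma partition_into_mono: "partition_into D I F A \<Longrightarrow> D \<subseteq> E \<Longrightarrow> partition_into E I F A"
  by (auto simp: partition_into_def)

text \<open>\<open>prod_decode\<close> turns the double family of pieces into one sequence, so that
  the refined partition is again indexed by \<open>nat\<close>.\<close>

lemma partition_into_nested:
  assumes F: "partition_into E UNIV F A"
    and P: "\<And>i::nat. partition_into D UNIV (P i) (F i)"
  shows "partition_into D UNIV (\<lambda>n. P (fst (prod_decode n)) (snd (prod_decode n))) A"
proof -
  have "P i j \<inter> P i' j' = {}" if "(i, j) \<noteq> (i', j')" for i j i' j'
  proof (cases "i = i'")
    case True
    then show ?thesis
      using P[of i] that by (auto simp: partition_into_def disjoint_family_on_def)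
  next
    case False
    have "P i j \<subseteq> F i" "P i' j' \<subseteq> F i'"
      using P by (auto simp: partition_into_def)
    moreover have "F i \<inter> F i' = {}"
      using F False by (auto simp: partition_into_def disjoint_family_on_def)
    ultimately show ?thesis by blast
  qed
  then have "disjoint_family (\<lambda>n. P (fst (prod_decode n)) (snd (prod_decode n)))"
    by (auto simp: disjoint_family_on_def) (metis disjoint_iff prod.collapse prod_decode_eq)
  moreover have "(\<Union>n. P (fst (prod_decode n)) (snd (prod_decode n))) = A"
  proof -
    have "(\<Union>n. P (fst (prod_decode n)) (snd (prod_decode n))) =
        (\<Union>p\<in>range prod_decode. P (fst p) (snd p))"
      by simp
    also have "\<dots> = (\<Union>i. \<Union>j. P i j)"
      by (force simp: surj_prod_decode)
    also have "\<dots> = A"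
      using partition_into_Union[OF F] partition_into_Union[OF P] by simp
    finally show ?thesis .
  qed
  moreover have "P i j \<in> D" for i j
    using partition_into_mem[OF P] by simp
  ultimately show ?thesis
    by (auto simp: partition_into_def)
qed

text \<open>For a sigma-ring \<open>\<Q>\<close> this is another description of the delta-rings that
  generate \<open>\<Q>\<close>, as \<open>exhausting_ideal_iff\<close> shows. In this form stability
  under intersection and refinement of partitions are easy to see.\<close>

definition exhausting_ideal :: "'x set set \<Rightarrow> 'x set set \<Rightarrow> bool" where
  "exhausting_ideal \<Q> D \<longleftrightarrow> D \<subseteq> \<Q> \<and> {} \<in> D \<and> (\<forall>A\<in>D. \<forall>B\<in>\<Q>. B \<subseteq> A \<longrightarrow> B \<in> D) \<and>
     (\<forall>A\<in>D. \<forall>B\<in>D. A \<union> B \<in> D) \<and> (\<forall>X\<in>\<Q>. \<exists>F::nat \<Rightarrow> _. partition_into D UNIV F X)"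

lemma exhausting_ideal_subset: "exhausting_ideal \<Q> D \<Longrightarrow> D \<subseteq> \<Q>"
  by (simp add: exhausting_ideal_def)

lemma exhausting_ideal_empty: "exhausting_ideal \<Q> D \<Longrightarrow> {} \<in> D"
  by (simp add: exhausting_ideal_def)

lemma exhausting_ideal_down: "exhausting_ideal \<Q> D \<Longrightarrow> A \<in> D \<Longrightarrow> B \<in> \<Q> \<Longrightarrow> B \<subseteq> A \<Longrightarrow> B \<in> D"
  by (simp add: exhausting_ideal_def)

lemma exhausting_ideal_Un: "exhausting_ideal \<Q> D \<Longrightarrow> A \<in> D \<Longrightarrow> B \<in> D \<Longrightarrow> A \<union> B \<in> D"
  by (simp add: exhausting_ideal_def)

lemma exhausting_ideal_partition:
  assumes "exhausting_ideal \<Q> D" "X \<in> \<Q>"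
  obtains F :: "nat \<Rightarrow> _" where "partition_into D UNIV F X"
  using assms by (auto simp: exhausting_ideal_def)

section \<open>Closure properties of rings of sets\<close>

lemma set_ring_empty: "set_ring \<Q> \<Longrightarrow> {} \<in> \<Q>"
  by (simp add: set_ring_iff_ring_of_sets ring_of_sets_iff)

lemma set_ring_Int: "set_ring \<Q> \<Longrightarrow> A \<in> \<Q> \<Longrightarrow> B \<in> \<Q> \<Longrightarrow> A \<inter> B \<in> \<Q>"
  by (subst Diff_Diff_Int[symmetric]) (simp add: set_ring_def)

lemma sigma_ring_Int: "sigma_ring \<Q> \<Longrightarrow> A \<in> \<Q> \<Longrightarrow> B \<in> \<Q> \<Longrightarrow> A \<inter> B \<in> \<Q>"
  by (simp add: sigma_ring_def set_ring_Int)

lemma sigma_ring_Diff: "sigma_ring \<Q> \<Longrightarrow> A \<in> \<Q> \<Longrightarrow> B \<in> \<Q> \<Longrightarrow> A - B \<in> \<Q>"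
  by (simp add: sigma_ring_def set_ring_def)

lemma sigma_ring_Union: "sigma_ring \<Q> \<Longrightarrow> \<C> \<subseteq> \<Q> \<Longrightarrow> countable \<C> \<Longrightarrow> \<Union>\<C> \<in> \<Q>"
  by (simp add: sigma_ring_def)

lemma delta_ring_Inter: "delta_ring \<Q> \<Longrightarrow> \<C> \<subseteq> \<Q> \<Longrightarrow> countable \<C> \<Longrightarrow> \<C> \<noteq> {} \<Longrightarrow> \<Inter>\<C> \<in> \<Q>"
  by (simp add: delta_ring_def)

text \<open>De Morgan inside the bound \<open>A\<close>: relative complements turn the union into a
  countable intersection. The empty family is separate because only nonempty intersections are
  available.\<close>

lemma delta_ring_UN_bounded:
  assumes D: "delta_ring D" and C: "countable \<C>" "\<C> \<subseteq> D" and A: "A \<in> D" "\<And>C. C \<in> \<C> \<Longrightarrow> C \<subseteq> A"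
  shows "\<Union>\<C> \<in> D"
proof (cases "\<C> = {}")
  case True
  then show ?thesis
    using D by (simp add: delta_ring_def set_ring_empty)
next
  case False
  have "(\<lambda>C. A - C) ` \<C> \<subseteq> D"
  proof (rule image_subsetI)
    fix C assume "C \<in> \<C>"
    then have "C \<in> D" using C(2) by blast
    with A(1) show "A - C \<in> D"
      using D by (simp add: delta_ring_def set_ring_def)
  qed
  moreover have "countable ((\<lambda>C. A - C) ` \<C>)" "(\<lambda>C. A - C) ` \<C> \<noteq> {}"
    using C False by auto
  ultimately have "\<Inter>((\<lambda>C. A - C) ` \<C>) \<in> D"
    by (rule delta_ring_Inter[OF D])
  then have "A - \<Inter>((\<lambda>C. A - C) ` \<C>) \<in> D"
    using D A by (simp add: delta_ring_def set_ring_def)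
  moreover have "A - \<Inter>((\<lambda>C. A - C) ` \<C>) = \<Union>\<C>"
    using A(2) by blast
  ultimately show ?thesis by simp
qed

lemma sigma_ring_imp_delta_ring:
  assumes "sigma_ring \<Q>"
  shows "delta_ring \<Q>"
  unfolding delta_ring_def
proof (intro conjI allI impI)
  show "set_ring \<Q>"
    using assms by (simp add: sigma_ring_def)
  fix \<C> assume C: "\<C> \<subseteq> \<Q> \<and> countable \<C> \<and> \<C> \<noteq> {}"
  then obtain A where A: "A \<in> \<C>" by blast
  have "(\<lambda>C. A - C) ` \<C> \<subseteq> \<Q>"
    using A C by (intro image_subsetI sigma_ring_Diff[OF assms]) auto
  then have "\<Union>((\<lambda>C. A - C) ` \<C>) \<in> \<Q>"
    using C by (intro sigma_ring_Union[OF assms]) auto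
  then have "A - \<Union>((\<lambda>C. A - C) ` \<C>) \<in> \<Q>"
    using A C by (intro sigma_ring_Diff[OF assms]) auto
  moreover have "A - \<Union>((\<lambda>C. A - C) ` \<C>) = \<Inter>\<C>"
    using A by blast
  ultimately show "\<Inter>\<C> \<in> \<Q>" by simp
qed

text \<open>The sets whose traces on members of \<open>D\<close> lie in \<open>D\<close> and which
  are covered by countably many members of \<open>D\<close> form a sigma-ring \<open>S\<close>
  containing \<open>D\<close>, hence containing the hull. The trace condition yields the ideal
  property; together with the cover it yields partitions.\<close>

lemma exhausting_ideal_hull:
  assumes D: "delta_ring D"
  shows "exhausting_ideal (sigma_ring hull D) D"
proof -
  have ring: "set_ring D"
    using D by (simp add: delta_ring_def)
  define S where "S = {X. (\<forall>A\<in>D. X \<inter> A \<in> D) \<and> (\<exists>\<C>. countable \<C> \<and> \<C> \<subseteq> D \<and> X \<subseteq> \<Union>\<C>)}"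
  have S_Int: "X \<inter> A \<in> D" if "X \<in> S" "A \<in> D" for X A
    using that unfolding S_def by blast
  have S_cover: "\<exists>\<C>. countable \<C> \<and> \<C> \<subseteq> D \<and> X \<subseteq> \<Union>\<C>" if "X \<in> S" for X
    using that unfolding S_def by blast
  have SI: "X \<in> S" if "\<And>A. A \<in> D \<Longrightarrow> X \<inter> A \<in> D" "countable \<C>" "\<C> \<subseteq> D" "X \<subseteq> \<Union>\<C>" for X \<C>
    using that unfolding S_def by blast
  have "D \<subseteq> S"
  proof
    fix A assume "A \<in> D"
    then show "A \<in> S"
      using set_ring_Int[OF ring] by (intro SI[of A "{A}"]) auto
  qed
  moreover have "sigma_ring S"
    unfolding sigma_ring_def set_ring_def
  proof (intro conjI ballI allI impI)
    show "S \<noteq> {}"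
      using \<open>D \<subseteq> S\<close> ring unfolding set_ring_def by blast
  next
    fix X Y assume X: "X \<in> S" and Y: "Y \<in> S"
    obtain \<C> \<C>' where C: "countable \<C>" "\<C> \<subseteq> D" "X \<subseteq> \<Union>\<C>" "countable \<C>'" "\<C>' \<subseteq> D" "Y \<subseteq> \<Union>\<C>'"
      using S_cover[OF X] S_cover[OF Y] by blast
    show "X \<union> Y \<in> S"
    proof (rule SI)
      show "(X \<union> Y) \<inter> A \<in> D" if "A \<in> D" for A
        using S_Int[OF X that] S_Int[OF Y that] ring by (simp add: set_ring_def Int_Un_distrib2)
      show "countable (\<C> \<union> \<C>')" "\<C> \<union> \<C>' \<subseteq> D" "X \<union> Y \<subseteq> \<Union>(\<C> \<union> \<C>')"
        using C by auto
    qed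
    show "X - Y \<in> S"
    proof (rule SI)
      show "(X - Y) \<inter> A \<in> D" if "A \<in> D" for A
      proof -
        have "X \<inter> A - Y \<inter> A \<in> D"
          using S_Int[OF X that] S_Int[OF Y that] ring by (simp add: set_ring_def)
        moreover have "(X - Y) \<inter> A = X \<inter> A - Y \<inter> A" by blast
        ultimately show ?thesis by simp
      qed
      show "countable \<C>" "\<C> \<subseteq> D" "X - Y \<subseteq> \<Union>\<C>"
        using C by auto
    qed
  next
    fix \<X> assume X: "\<X> \<subseteq> S \<and> countable \<X>"
    obtain c where c: "\<And>X. X \<in> \<X> \<Longrightarrow> countable (c X) \<and> c X \<subseteq> D \<and> X \<subseteq> \<Union>(c X)"
      using S_cover X subsetD by metis
    show "\<Union>\<X> \<in> S"
    proof (rule SI)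
      show "countable (\<Union>(c ` \<X>))"
        using X c by (intro countable_UN) auto
      show "\<Union>(c ` \<X>) \<subseteq> D"
        using c by (intro UN_least) simp
      show "\<Union>\<X> \<subseteq> \<Union>(\<Union>(c ` \<X>))"
      proof (rule Union_least)
        fix X assume "X \<in> \<X>"
        then have "X \<subseteq> \<Union>(c X)" "c X \<subseteq> \<Union>(c ` \<X>)"
          using c by auto
        then show "X \<subseteq> \<Union>(\<Union>(c ` \<X>))"
          by blast
      qed
      fix A assume A: "A \<in> D"
      \<comment> \<open>Cut down to \<open>A\<close>, the union is bounded by a member of
        \<open>D\<close>, and bounded countable unions stay in a delta-ring.\<close>
      have "\<Union>((\<lambda>X. X \<inter> A) ` \<X>) \<in> D"
      proof (rule delta_ring_UN_bounded[OF D _ _ A])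
        show "(\<lambda>X. X \<inter> A) ` \<X> \<subseteq> D"
          using X A by (intro image_subsetI S_Int) auto
      qed (use X in auto)
      then show "\<Union>\<X> \<inter> A \<in> D"
        by (simp only: Int_Union2)
    qed
  qed
  ultimately have hull: "sigma_ring hull D \<subseteq> S"
    by (intro hull_minimal)
  show ?thesis
    unfolding exhausting_ideal_def
  proof (intro conjI ballI impI)
    show "D \<subseteq> sigma_ring hull D" by (rule hull_subset)
    show "{} \<in> D" using ring by (rule set_ring_empty)
  next
    fix A B assume "A \<in> D" "B \<in> sigma_ring hull D" "B \<subseteq> A"
    then have "B \<inter> A \<in> D"
      using hull by (auto simp: S_def)
    then show "B \<in> D"
      using \<open>B \<subseteq> A\<close> by (simp add: Int_absorb2)
  next
    fix A B assume "A \<in> D" "B \<in> D"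
    then show "A \<union> B \<in> D"
      using ring by (simp add: set_ring_def)
  next
    fix X assume "X \<in> sigma_ring hull D"
    with hull have XS: "X \<in> S"
      by blast
    then obtain \<C> where C: "countable \<C>" "\<C> \<subseteq> D" "X \<subseteq> \<Union>\<C>"
      unfolding S_def by blast
    \<comment> \<open>Inserting the empty set makes the cover nonempty, so
      \<open>from_nat_into\<close> enumerates it, and leaves its union unchanged.\<close>
    define c where "c = from_nat_into (insert {} \<C>)"
    have range_c: "range c = insert {} \<C>"
      using C by (simp add: c_def range_from_nat_into)
    define F where "F = disjointed (\<lambda>n. X \<inter> c n)"
    interpret ring_of_sets UNIV D
      using ring by (simp add: set_ring_iff_ring_of_sets)
    have "c n \<in> D" for n
    proof -
      have "c n \<in> insert {} \<C>"
        using range_c by blast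
      then show ?thesis
        using C empty_sets by (elim insertE) auto
    qed
    then have "range F \<subseteq> D"
      unfolding F_def using S_Int[OF XS] by (intro range_disjointed_sets) auto
    moreover have "(\<Union>n. F n) = X"
    proof -
      have "(\<Union>n. F n) = X \<inter> \<Union>(range c)"
        unfolding F_def UN_disjointed_eq by (rule Int_UN_distrib[symmetric])
      then show ?thesis
        using range_c C by auto
    qed
    ultimately show "\<exists>F::nat \<Rightarrow> _. partition_into D UNIV F X"
      unfolding partition_into_def F_def using disjoint_family_disjointed by blast
  qed
qed

text \<open>Differences and countable intersections exist in \<open>\<Q>\<close> and lie below a
  member of \<open>D\<close>, so the ideal property returns them to \<open>D\<close>.\<close>

lemma exhausting_ideal_imp_delta_ring:
  assumes Q: "sigma_ring \<Q>" and D: "exhausting_ideal \<Q> D"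
  shows "delta_ring D"
  unfolding delta_ring_def set_ring_def
proof (intro conjI ballI allI impI)
  show "D \<noteq> {}"
    using exhausting_ideal_empty[OF D] by blast
next
  fix A B assume AB: "A \<in> D" "B \<in> D"
  then show "A \<union> B \<in> D"
    by (rule exhausting_ideal_Un[OF D])
  have "A - B \<in> \<Q>"
    using AB exhausting_ideal_subset[OF D] by (intro sigma_ring_Diff[OF Q]) auto
  with AB show "A - B \<in> D"
    using exhausting_ideal_down[OF D] by blast
next
  fix \<C> assume C: "\<C> \<subseteq> D \<and> countable \<C> \<and> \<C> \<noteq> {}"
  then obtain A where A: "A \<in> \<C>" by blast
  have "\<Inter>\<C> \<in> \<Q>"
    using C exhausting_ideal_subset[OF D]
    by (intro delta_ring_Inter[OF sigma_ring_imp_delta_ring[OF Q]]) auto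
  then show "\<Inter>\<C> \<in> D"
    using exhausting_ideal_down[OF D, of A "\<Inter>\<C>"] A C by blast
qed

lemma exhausting_ideal_imp_hull:
  assumes Q: "sigma_ring \<Q>" and D: "exhausting_ideal \<Q> D"
  shows "sigma_ring hull D = \<Q>"
proof
  show "sigma_ring hull D \<subseteq> \<Q>"
    using assms exhausting_ideal_subset by (intro hull_minimal) auto
  show "\<Q> \<subseteq> sigma_ring hull D"
  proof
    fix X assume "X \<in> \<Q>"
    then obtain F :: "nat \<Rightarrow> _" where F: "partition_into D UNIV F X"
      by (rule exhausting_ideal_partition[OF D])
    have "\<Union>(range F) \<in> sigma_ring hull D"
      using F hull_subset[of D sigma_ring]
      by (intro sigma_ring_Union[OF sigma_ring_hull]) (auto simp: partition_into_def)
    then show "X \<in> sigma_ring hull D"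
      using partition_into_Union[OF F] by simp
  qed
qed

lemma exhausting_ideal_iff:
  assumes "sigma_ring \<Q>"
  shows "exhausting_ideal \<Q> D \<longleftrightarrow> delta_ring D \<and> sigma_ring hull D = \<Q>"
  using exhausting_ideal_hull[of D] exhausting_ideal_imp_delta_ring[OF assms]
    exhausting_ideal_imp_hull[OF assms] by (intro iffI) auto

lemma exhausting_ideal_self:
  assumes "sigma_ring \<Q>"
  shows "exhausting_ideal \<Q> \<Q>"
  using assms by (simp add: exhausting_ideal_iff sigma_ring_imp_delta_ring hull_same)

text \<open>Members of a partition into \<open>D\<close> are partitioned further into
  \<open>E\<close>; the pieces remain in \<open>D\<close> because they lie below members of
  \<open>D\<close>.\<close>

lemma exhausting_ideal_Int:
  assumes Q: "sigma_ring \<Q>" and D: "exhausting_ideal \<Q> D" and E: "exhausting_ideal \<Q> E"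
  shows "exhausting_ideal \<Q> (D \<inter> E)"
  unfolding exhausting_ideal_def
proof (intro conjI ballI impI)
  fix X assume X: "X \<in> \<Q>"
  obtain F :: "nat \<Rightarrow> _" where F: "partition_into D UNIV F X"
    using X by (rule exhausting_ideal_partition[OF D])
  have FD: "F i \<in> D" for i
    using partition_into_mem[OF F] by simp
  then have "\<exists>G::nat \<Rightarrow> _. partition_into E UNIV G (F i)" for i
    using exhausting_ideal_partition[OF E] exhausting_ideal_subset[OF D] by blast
  then obtain P :: "nat \<Rightarrow> nat \<Rightarrow> _" where P: "\<And>i. partition_into E UNIV (P i) (F i)"
    by metis
  have "partition_into (D \<inter> E) UNIV (P i) (F i)" for i
  proof -
    have "P i j \<in> D" for j
    proof (rule exhausting_ideal_down[OF D FD[of i]])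
      show "P i j \<in> \<Q>"
        using P[of i] exhausting_ideal_subset[OF E] by (auto simp: partition_into_def)
      show "P i j \<subseteq> F i"
        using P[of i] by (auto simp: partition_into_def)
    qed
    then show ?thesis
      using P[of i] by (auto simp: partition_into_def)
  qed
  then show "\<exists>G::nat \<Rightarrow> _. partition_into (D \<inter> E) UNIV G X"
    using partition_into_nested[OF F] by blast
next
  show "D \<inter> E \<subseteq> \<Q>" "{} \<in> D \<inter> E"
    using exhausting_ideal_subset[OF D] exhausting_ideal_empty[OF D] exhausting_ideal_empty[OF E]
    by auto
  show "B \<in> D \<inter> E" if "A \<in> D \<inter> E" "B \<in> \<Q>" "B \<subseteq> A" for A B
    using that exhausting_ideal_down[OF D] exhausting_ideal_down[OF E] by blast
  show "A \<union> B \<in> D \<inter> E" if "A \<in> D \<inter> E" "B \<in> D \<inter> E" for A B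
    using that exhausting_ideal_Un[OF D] exhausting_ideal_Un[OF E] by blast
qed

section \<open>Premeasures\<close>

lemma host_sigma_ring: "sigma_ring (host \<mu>)"
  by (simp add: host_def sigma_ring_hull)

lemma premeasure_ideal: "premeasure T \<mu> \<Longrightarrow> exhausting_ideal (host \<mu>) (dom \<mu>)"
  by (simp add: premeasure_def host_def exhausting_ideal_hull)

lemma premeasure_euclidean_has_sum:
  assumes "premeasure euclidean \<mu>" "A \<in> dom \<mu>" "partition_into (dom \<mu>) (I :: nat set) F A"
  shows "((\<lambda>i. the (\<mu> (F i))) has_sum the (\<mu> A)) I"
  using assms by (auto simp: premeasure_def has_sum_in_euclidean)

text \<open>Countable additivity is applied to the partition with empty index set, whose sum is
  0.\<close>

lemma premeasure_empty:
  fixes \<mu> :: "'x set \<rightharpoonup> 'a::{topological_ab_group_add, t2_space}"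
  assumes "premeasure euclidean \<mu>"
  shows "the (\<mu> {}) = 0"
proof -
  have "partition_into (dom \<mu>) ({} :: nat set) (\<lambda>_. {}) {}"
    by (simp add: partition_into_def disjoint_family_on_def)
  then have "((\<lambda>i::nat. the (\<mu> {})) has_sum the (\<mu> {})) {}"
    using assms exhausting_ideal_empty[OF premeasure_ideal[OF assms]]
    by (intro premeasure_euclidean_has_sum) auto
  then show ?thesis
    by (rule has_sum_unique) simp
qed

text \<open>Reduces countable additivity to sequences: a family over \<open>I\<close> is padded with
  the empty set outside \<open>I\<close>, and the padding contributes only zeros.\<close>

lemma premeasure_euclideanI:
  fixes \<mu> :: "'x set \<rightharpoonup> 'a::{topological_ab_group_add, t2_space}"
  assumes D: "delta_ring (dom \<mu>)" and empty: "the (\<mu> {}) = 0"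
    and sum: "\<And>A (F :: nat \<Rightarrow> _). A \<in> dom \<mu> \<Longrightarrow> partition_into (dom \<mu>) UNIV F A
      \<Longrightarrow> ((\<lambda>i. the (\<mu> (F i))) has_sum the (\<mu> A)) UNIV"
  shows "premeasure euclidean \<mu>"
  unfolding premeasure_def has_sum_in_euclidean
proof (intro conjI ballI allI impI)
  fix A and I :: "nat set" and F
  assume A: "A \<in> dom \<mu>" and F: "partition_into (dom \<mu>) I F A"
  define G where "G i = (if i \<in> I then F i else {})" for i
  have "{} \<in> dom \<mu>"
    using D by (simp add: delta_ring_def set_ring_empty)
  then have "range G \<subseteq> dom \<mu>" "disjoint_family G"
    using F by (auto simp: partition_into_def G_def disjoint_family_on_def)
  moreover have "(\<Union>i. G i) = A"
    using F by (auto simp: partition_into_def G_def split: if_splits)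
  ultimately have "partition_into (dom \<mu>) UNIV G A"
    by (simp add: partition_into_def)
  then have "((\<lambda>i. the (\<mu> (G i))) has_sum the (\<mu> A)) UNIV"
    by (rule sum[OF A])
  also have "?this \<longleftrightarrow> ((\<lambda>i. the (\<mu> (F i))) has_sum the (\<mu> A)) I"
    by (rule has_sum_cong_neutral) (auto simp: G_def empty)
  finally show "((\<lambda>i. the (\<mu> (F i))) has_sum the (\<mu> A)) I" .
qed (use D in auto)

text \<open>Both values are sums of the same series over a partition of \<open>A\<close> into
  \<open>E\<close>, and sums are unique in a Hausdorff group.\<close>

lemma premeasures_agree:
  fixes \<mu> \<nu> :: "'x set \<rightharpoonup> 'a::{topological_ab_group_add, t2_space}"
  assumes \<mu>: "premeasure euclidean \<mu>" "host \<mu> = \<Q>" and \<nu>: "premeasure euclidean \<nu>"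
    and E: "exhausting_ideal \<Q> E" "E \<subseteq> dom \<mu> \<inter> dom \<nu>" "\<And>A. A \<in> E \<Longrightarrow> \<mu> A = \<nu> A"
    and A: "A \<in> dom \<mu> \<inter> dom \<nu>"
  shows "\<mu> A = \<nu> A"
proof -
  have "A \<in> \<Q>"
    using A \<mu> exhausting_ideal_subset[OF premeasure_ideal[OF \<mu>(1)]] by auto
  then obtain F :: "nat \<Rightarrow> _" where F: "partition_into E UNIV F A"
    by (rule exhausting_ideal_partition[OF E(1)])
  have "((\<lambda>i. the (\<mu> (F i))) has_sum the (\<mu> A)) UNIV"
    using A E(2) by (intro premeasure_euclidean_has_sum[OF \<mu>(1)] partition_into_mono[OF F]) auto
  moreover have "((\<lambda>i. the (\<nu> (F i))) has_sum the (\<nu> A)) UNIV"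
    using A E(2) by (intro premeasure_euclidean_has_sum[OF \<nu>] partition_into_mono[OF F]) auto
  moreover have "\<mu> (F i) = \<nu> (F i)" for i
    using E(3) partition_into_mem[OF F] by simp
  ultimately have "the (\<mu> A) = the (\<nu> A)"
    by (simp add: has_sum_unique)
  then show ?thesis
    using A by auto
qed

section \<open>The associated measure\<close>

lemma seq_closedD: "seq_closed S \<Longrightarrow> (\<And>n. x n \<in> S) \<Longrightarrow> x \<longlonglongrightarrow> l \<Longrightarrow> l \<in> S"
  unfolding seq_closed_def by blast

lemma dom_pointwise_sum: "dom (pointwise_sum \<mu> \<nu>) = dom \<mu> \<inter> dom \<nu>"
  by (auto simp: pointwise_sum_def split: if_splits)

text \<open>One development serves the whole group (\<open>B = UNIV\<close>) and a subset: values
  are confined to \<open>B\<close>, while convergence is computed in the ambient group.\<close>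

locale value_monoid =
  fixes B :: "'a::{topological_ab_group_add, t2_space} set"
  assumes zero_mem: "0 \<in> B" and add_mem: "x \<in> B \<Longrightarrow> y \<in> B \<Longrightarrow> x + y \<in> B"
begin

lemma sum_mem: "(\<And>i. i \<in> J \<Longrightarrow> f i \<in> B) \<Longrightarrow> sum f J \<in> B"
  by (induction J rule: infinite_finite_induct) (auto simp: zero_mem add_mem)

text \<open>All partial sums stay in \<open>B\<close>, so convergence to a point of \<open>B\<close>
  is the same in the induced and in the ambient topology.\<close>

lemma premeasure_iff:
  "premeasure (top_of_set B) \<mu> \<longleftrightarrow> ran \<mu> \<subseteq> B \<and> premeasure euclidean \<mu>"
proof -
  have "has_sum_in (top_of_set B) (\<lambda>i. the (\<mu> (F i))) I (the (\<mu> A)) \<longleftrightarrow>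
      has_sum_in euclidean (\<lambda>i. the (\<mu> (F i))) I (the (\<mu> A))"
    if "ran \<mu> \<subseteq> B" "A \<in> dom \<mu>" "partition_into (dom \<mu>) I F A" for A F and I :: "nat set"
  proof -
    have mem: "the (\<mu> X) \<in> B" if "X \<in> dom \<mu>" for X
      using \<open>ran \<mu> \<subseteq> B\<close> that by (auto simp: ran_def)
    have "the (\<mu> (F i)) \<in> B" if "i \<in> I" for i
      by (rule mem[OF partition_into_mem[OF \<open>partition_into (dom \<mu>) I F A\<close> that]])
    then have "eventually (\<lambda>J. (\<Sum>i\<in>J. the (\<mu> (F i))) \<in> B) (finite_subsets_at_top I)"
      by (intro eventually_finite_subsets_at_top_weakI sum_mem) auto
    then show ?thesis
      using that mem by (simp add: has_sum_in_def limitin_subtopology)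
  qed
  then show ?thesis
    by (cases "ran \<mu> \<subseteq> B") (simp_all add: premeasure_def)
qed

text \<open>
  Summability is required over every \<open>C \<subseteq> A\<close> because in a group that is not complete a subfamily
  of a summable family need not be summable.
\<close>

definition extension_domain :: "('x set \<rightharpoonup> 'a) \<Rightarrow> 'x set set" where
  "extension_domain \<mu> = {A \<in> host \<mu>. \<forall>C\<in>host \<mu>. C \<subseteq> A \<longrightarrow>
     (\<forall>F::nat \<Rightarrow> _. partition_into (dom \<mu>) UNIV F C \<longrightarrow>
        (\<exists>s\<in>B. ((\<lambda>i. the (\<mu> (F i))) has_sum s) UNIV))}"

text \<open>The description is meaningful once the sum is independent of the partition, which
  \<open>extension_sum_unique\<close> establishes on the extension domain.\<close>

definition extension_value :: "('x set \<rightharpoonup> 'a) \<Rightarrow> 'x set \<Rightarrow> 'a" where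
  "extension_value \<mu> A =
     (THE s. \<exists>F::nat \<Rightarrow> _. partition_into (dom \<mu>) UNIV F A \<and> ((\<lambda>i. the (\<mu> (F i))) has_sum s) UNIV)"

definition extension :: "('x set \<rightharpoonup> 'a) \<Rightarrow> ('x set \<rightharpoonup> 'a)" where
  "extension \<mu> = (\<lambda>A. if A \<in> extension_domain \<mu> then Some (extension_value \<mu> A) else None)"

lemma dom_extension: "dom (extension \<mu>) = extension_domain \<mu>"
  by (auto simp: extension_def split: if_splits)

lemma extension_domain_down:
  "A \<in> extension_domain \<mu> \<Longrightarrow> C \<in> host \<mu> \<Longrightarrow> C \<subseteq> A \<Longrightarrow> C \<in> extension_domain \<mu>"
  by (simp add: extension_domain_def)

lemma extension_domain_summable:
  assumes "A \<in> extension_domain \<mu>" "partition_into (dom \<mu>) UNIV (F :: nat \<Rightarrow> _) A"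
  obtains s where "s \<in> B" "((\<lambda>i. the (\<mu> (F i))) has_sum s) UNIV"
  using assms by (auto simp: extension_domain_def)

text \<open>The pieces of all \<open>F i\<close> together partition \<open>A\<close> itself, so
  membership in the extension domain provides the summability over pairs that iterated summation
  requires.\<close>

lemma extension_domain_nested_summable:
  fixes P :: "nat \<Rightarrow> nat \<Rightarrow> 'x set"
  assumes A: "A \<in> extension_domain \<mu>" and F: "partition_into E UNIV F A"
    and P: "\<And>i. partition_into (dom \<mu>) UNIV (P i) (F i)"
  obtains s where "((\<lambda>(i, j). the (\<mu> (P i j))) has_sum s) UNIV"
proof -
  obtain s where "((\<lambda>n. the (\<mu> (P (fst (prod_decode n)) (snd (prod_decode n))))) has_sum s) UNIV"
    using extension_domain_summable[OF A partition_into_nested[OF F P]] by blast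
  also have "?this \<longleftrightarrow> ((\<lambda>(i, j). the (\<mu> (P i j))) has_sum s) UNIV"
    using has_sum_reindex_bij_betw[OF bij_prod_decode, of "\<lambda>(i, j). the (\<mu> (P i j))" s]
    by (simp add: case_prod_beta)
  finally show ?thesis by (rule that)
qed

text \<open>Both sums equal the sum over the refinement \<open>F i \<inter> G j\<close>. Additivity
  of \<open>\<mu>\<close> on each \<open>F i\<close> evaluates the row sums, and on each
  \<open>G j\<close> the column sums.\<close>

lemma extension_sum_unique:
  fixes F G :: "nat \<Rightarrow> 'x set"
  assumes \<mu>: "premeasure euclidean \<mu>" and A: "A \<in> extension_domain \<mu>"
    and F: "partition_into (dom \<mu>) UNIV F A" "((\<lambda>i. the (\<mu> (F i))) has_sum s) UNIV"
    and G: "partition_into (dom \<mu>) UNIV G A" "((\<lambda>i. the (\<mu> (G i))) has_sum t) UNIV"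
  shows "s = t"
proof -
  have "set_ring (dom \<mu>)"
    using \<mu> by (simp add: premeasure_def delta_ring_def)
  note Int = set_ring_Int[OF this]
  have FG: "partition_into (dom \<mu>) UNIV (\<lambda>j. F i \<inter> G j) (F i)" for i
  proof -
    have "partition_into (dom \<mu>) UNIV (\<lambda>j. F i \<inter> G j) (F i \<inter> A)"
      using F G by (intro partition_into_inter Int) (auto dest: partition_into_mem)
    moreover have "F i \<inter> A = F i"
      using partition_into_Union[OF F(1)] by auto
    ultimately show ?thesis by simp
  qed
  have GF: "partition_into (dom \<mu>) UNIV (\<lambda>i. F i \<inter> G j) (G j)" for j
  proof -
    have "partition_into (dom \<mu>) UNIV (\<lambda>i. G j \<inter> F i) (G j \<inter> A)"
      using F G by (intro partition_into_inter Int) (auto dest: partition_into_mem)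
    moreover have "G j \<inter> A = G j"
      using partition_into_Union[OF G(1)] by auto
    ultimately show ?thesis by (simp add: Int_commute)
  qed
  obtain r where r: "((\<lambda>(i, j). the (\<mu> (F i \<inter> G j))) has_sum r) (UNIV \<times> UNIV)"
    using extension_domain_nested_summable[OF A F(1) FG] by auto
  have "((\<lambda>i. the (\<mu> (F i))) has_sum r) UNIV"
  proof (rule has_sum_Sigma_group[OF r])
    fix i
    show "((\<lambda>j. case (i, j) of (i, j) \<Rightarrow> the (\<mu> (F i \<inter> G j))) has_sum the (\<mu> (F i))) UNIV"
      using premeasure_euclidean_has_sum[OF \<mu> _ FG] partition_into_mem[OF F(1)] by simp
  qed
  then have "s = r"
    using F(2) has_sum_unique by blast
  \<comment> \<open>Swapping coordinates lets the same iterated summation lemma run over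
    columns.\<close>
  have r': "((\<lambda>(j, i). the (\<mu> (F i \<inter> G j))) has_sum r) (UNIV \<times> UNIV)"
    using r has_sum_reindex_bij_betw[OF bij_swap, of "\<lambda>(i, j). the (\<mu> (F i \<inter> G j))" r]
    by (simp add: case_prod_beta')
  have "((\<lambda>j. the (\<mu> (G j))) has_sum r) UNIV"
  proof (rule has_sum_Sigma_group[OF r'])
    fix j
    show "((\<lambda>i. case (j, i) of (j, i) \<Rightarrow> the (\<mu> (F i \<inter> G j))) has_sum the (\<mu> (G j))) UNIV"
      using premeasure_euclidean_has_sum[OF \<mu> _ GF] partition_into_mem[OF G(1)] by simp
  qed
  then have "t = r"
    using G(2) has_sum_unique by blast
  with \<open>s = r\<close> show ?thesis by simp
qed

lemma extension_value_has_sum: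
  assumes \<mu>: "premeasure euclidean \<mu>" and A: "A \<in> extension_domain \<mu>"
    and F: "partition_into (dom \<mu>) UNIV (F :: nat \<Rightarrow> _) A"
  shows "((\<lambda>i. the (\<mu> (F i))) has_sum extension_value \<mu> A) UNIV" and "extension_value \<mu> A \<in> B"
proof -
  obtain s where s: "s \<in> B" "((\<lambda>i. the (\<mu> (F i))) has_sum s) UNIV"
    using extension_domain_summable[OF A F] by blast
  have "extension_value \<mu> A = s"
    unfolding extension_value_def
    using F s extension_sum_unique[OF \<mu> A] by (intro the_equality) auto
  with s show "((\<lambda>i. the (\<mu> (F i))) has_sum extension_value \<mu> A) UNIV" "extension_value \<mu> A \<in> B"
    by auto
qed

lemma dom_subset_extension_domain:
  assumes \<mu>: "premeasure euclidean \<mu>" "ran \<mu> \<subseteq> B"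
  shows "dom \<mu> \<subseteq> extension_domain \<mu>"
proof
  fix A assume A: "A \<in> dom \<mu>"
  note ideal = premeasure_ideal[OF \<mu>(1)]
  show "A \<in> extension_domain \<mu>"
    unfolding extension_domain_def
  proof (intro CollectI conjI ballI allI impI)
    show "A \<in> host \<mu>"
      using A exhausting_ideal_subset[OF ideal] by blast
    fix C and F :: "nat \<Rightarrow> _"
    assume C: "C \<in> host \<mu>" "C \<subseteq> A" and F: "partition_into (dom \<mu>) UNIV F C"
    have "C \<in> dom \<mu>"
      by (rule exhausting_ideal_down[OF ideal A C])
    moreover from this have "the (\<mu> C) \<in> B"
      using \<mu>(2) by (auto simp: ran_def)
    ultimately show "\<exists>s\<in>B. ((\<lambda>i. the (\<mu> (F i))) has_sum s) UNIV"
      using premeasure_euclidean_has_sum[OF \<mu>(1) _ F] by blast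
  qed
qed

text \<open>A subset \<open>C\<close> of the union splits into \<open>X \<inter> C\<close> and
  \<open>(Y - X) \<inter> C\<close>. Cutting a partition of \<open>C\<close> accordingly gives two
  summable families that add termwise.\<close>

lemma extension_domain_Un:
  assumes \<mu>: "premeasure euclidean \<mu>" and X: "X \<in> extension_domain \<mu>" and Y: "Y \<in> extension_domain \<mu>"
  shows "X \<union> Y \<in> extension_domain \<mu>"
  unfolding extension_domain_def
proof (intro CollectI conjI ballI allI impI)
  note ideal = premeasure_ideal[OF \<mu>]
  have XY: "X \<in> host \<mu>" "Y \<in> host \<mu>"
    using X Y by (auto simp: extension_domain_def)
  then show "X \<union> Y \<in> host \<mu>"
    using host_sigma_ring[of \<mu>] by (simp add: sigma_ring_def set_ring_def)
  fix C and F :: "nat \<Rightarrow> _"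
  assume C: "C \<in> host \<mu>" "C \<subseteq> X \<union> Y" and F: "partition_into (dom \<mu>) UNIV F C"
  have Fdom: "F i \<in> dom \<mu>" for i
    using partition_into_mem[OF F] by simp
  have part: "partition_into (dom \<mu>) UNIV (\<lambda>i. Z \<inter> F i) (Z \<inter> C)" if "Z \<in> host \<mu>" for Z
  proof (rule partition_into_inter[OF F])
    fix i
    show "Z \<inter> F i \<in> dom \<mu>"
    proof (rule exhausting_ideal_down[OF ideal Fdom[of i]])
      show "Z \<inter> F i \<in> host \<mu>"
        using that Fdom[THEN subsetD[OF exhausting_ideal_subset[OF ideal]]]
        by (intro sigma_ring_Int[OF host_sigma_ring])
    qed simp
  qed
  have YX: "Y - X \<in> host \<mu>"
    using XY by (intro sigma_ring_Diff[OF host_sigma_ring])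
  have "X \<inter> C \<in> extension_domain \<mu>" "(Y - X) \<inter> C \<in> extension_domain \<mu>"
    using XY YX C by (auto intro: sigma_ring_Int[OF host_sigma_ring]
        extension_domain_down[OF X] extension_domain_down[OF Y])
  then obtain s t where st: "s \<in> B" "((\<lambda>i. the (\<mu> (X \<inter> F i))) has_sum s) UNIV"
      "t \<in> B" "((\<lambda>i. the (\<mu> ((Y - X) \<inter> F i))) has_sum t) UNIV"
    by (metis extension_domain_summable part[OF XY(1)] part[OF YX])
  have "the (\<mu> (F i)) = the (\<mu> (X \<inter> F i)) + the (\<mu> ((Y - X) \<inter> F i))" for i
  proof -
    \<comment> \<open>Finite additivity of \<open>\<mu>\<close> is the case of a partition with the
      two-element index set \<open>{0, 1}\<close>.\<close>
    define P where "P n = (if n = 0 then X \<inter> F i else (Y - X) \<inter> F i)" for n :: nat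
    have "F i \<subseteq> X \<union> Y"
      using C(2) partition_into_Union[OF F] by auto
    then have "partition_into (dom \<mu>) {0, 1} P (F i)"
      using partition_into_mem[OF part[OF XY(1)]] partition_into_mem[OF part[OF YX]]
      by (auto simp: partition_into_def P_def disjoint_family_on_def)
    then have "((\<lambda>n. the (\<mu> (P n))) has_sum the (\<mu> (F i))) {0, 1}"
      by (rule premeasure_euclidean_has_sum[OF \<mu> Fdom])
    then have "the (\<mu> (F i)) = (\<Sum>n\<in>{0, 1}. the (\<mu> (P n)))"
      by (rule has_sum_unique) (rule has_sum_finite, simp)
    then show ?thesis
      by (simp add: P_def)
  qed
  then have "((\<lambda>i. the (\<mu> (F i))) has_sum s + t) UNIV"
    using has_sum_add[OF st(2,4)] by simp
  then show "\<exists>s\<in>B. ((\<lambda>i. the (\<mu> (F i))) has_sum s) UNIV"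
    using st add_mem by blast
qed

lemma exhausting_ideal_extension_domain:
  assumes \<mu>: "premeasure euclidean \<mu>" "ran \<mu> \<subseteq> B"
  shows "exhausting_ideal (host \<mu>) (extension_domain \<mu>)"
  unfolding exhausting_ideal_def
proof (intro conjI ballI impI)
  note ideal = premeasure_ideal[OF \<mu>(1)]
  show "extension_domain \<mu> \<subseteq> host \<mu>"
    by (auto simp: extension_domain_def)
  show "{} \<in> extension_domain \<mu>"
    using dom_subset_extension_domain[OF \<mu>] exhausting_ideal_empty[OF ideal] by blast
  show "X \<in> extension_domain \<mu>" if "A \<in> extension_domain \<mu>" "X \<in> host \<mu>" "X \<subseteq> A" for A X
    using that by (rule extension_domain_down)
  show "X \<union> Y \<in> extension_domain \<mu>" if "X \<in> extension_domain \<mu>" "Y \<in> extension_domain \<mu>" for X Y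
    using that by (rule extension_domain_Un[OF \<mu>(1)])
  show "\<exists>F::nat \<Rightarrow> _. partition_into (extension_domain \<mu>) UNIV F X" if "X \<in> host \<mu>" for X
    using exhausting_ideal_partition[OF ideal that]
      partition_into_mono[OF _ dom_subset_extension_domain[OF \<mu>]] by metis
qed

lemma host_extension:
  assumes "premeasure euclidean \<mu>" "ran \<mu> \<subseteq> B"
  shows "host (extension \<mu>) = host \<mu>"
  unfolding host_def[of "extension \<mu>"] dom_extension
  by (rule exhausting_ideal_imp_hull[OF host_sigma_ring exhausting_ideal_extension_domain[OF assms]])

text \<open>Partitions of the sets \<open>F i\<close> into \<open>dom \<mu>\<close> combine to one
  of \<open>A\<close>, whose sum is the value at \<open>A\<close>. Summing it iteratedly, the inner
  sums are the values at the \<open>F i\<close>.\<close>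

lemma premeasure_extension:
  assumes \<mu>: "premeasure (top_of_set B) \<mu>"
  shows "premeasure (top_of_set B) (extension \<mu>)"
proof -
  have pm: "premeasure euclidean \<mu>" and ran: "ran \<mu> \<subseteq> B"
    using \<mu> by (auto simp: premeasure_iff)
  note ideal = premeasure_ideal[OF pm]
  note ideal' = exhausting_ideal_extension_domain[OF pm ran]
  have part: "\<exists>F::nat \<Rightarrow> _. partition_into (dom \<mu>) UNIV F A" if "A \<in> extension_domain \<mu>" for A
    using exhausting_ideal_partition[OF ideal] exhausting_ideal_subset[OF ideal'] that by blast
  have "premeasure euclidean (extension \<mu>)"
  proof (rule premeasure_euclideanI)
    show "delta_ring (dom (extension \<mu>))"
      unfolding dom_extension by (rule exhausting_ideal_imp_delta_ring[OF host_sigma_ring ideal'])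
    \<comment> \<open>The constantly empty sequence computes the value at the empty set as a sum of
      zeros.\<close>
    have "partition_into (dom \<mu>) UNIV (\<lambda>_::nat. {}) {}"
      using exhausting_ideal_empty[OF ideal] by (auto simp: partition_into_def disjoint_family_on_def)
    then have "((\<lambda>i::nat. the (\<mu> {})) has_sum extension_value \<mu> {}) UNIV"
      using exhausting_ideal_empty[OF ideal'] by (intro extension_value_has_sum[OF pm])
    then have "((\<lambda>i::nat. 0) has_sum extension_value \<mu> {}) UNIV"
      by (simp add: premeasure_empty[OF pm])
    then have "extension_value \<mu> {} = 0"
      by (rule has_sum_unique) (rule has_sum_0, simp)
    then show "the (extension \<mu> {}) = 0"
      using exhausting_ideal_empty[OF ideal'] by (simp add: extension_def)
  next
    fix A and F :: "nat \<Rightarrow> _"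
    assume "A \<in> dom (extension \<mu>)" "partition_into (dom (extension \<mu>)) UNIV F A"
    then have A: "A \<in> extension_domain \<mu>" and F: "partition_into (extension_domain \<mu>) UNIV F A"
      by (simp_all add: dom_extension)
    have FE: "F i \<in> extension_domain \<mu>" for i
      using partition_into_mem[OF F] by simp
    then have "\<exists>G::nat \<Rightarrow> _. partition_into (dom \<mu>) UNIV G (F i)" for i
      using part by blast
    then obtain P :: "nat \<Rightarrow> nat \<Rightarrow> _" where P: "\<And>i. partition_into (dom \<mu>) UNIV (P i) (F i)"
      by metis
    have "((\<lambda>n. the (\<mu> (P (fst (prod_decode n)) (snd (prod_decode n))))) has_sum
        extension_value \<mu> A) UNIV"
      by (rule extension_value_has_sum(1)[OF pm A partition_into_nested[OF F P]])
    then have "((\<lambda>(i, j). the (\<mu> (P i j))) has_sum extension_value \<mu> A) (UNIV \<times> UNIV)"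
      using has_sum_reindex_bij_betw[OF bij_prod_decode, of "\<lambda>(i, j). the (\<mu> (P i j))"]
      by (simp add: case_prod_beta)
    then have "((\<lambda>i. extension_value \<mu> (F i)) has_sum extension_value \<mu> A) UNIV"
      by (rule has_sum_Sigma_group) (use extension_value_has_sum(1)[OF pm FE P] in simp)
    then show "((\<lambda>i. the (extension \<mu> (F i))) has_sum the (extension \<mu> A)) UNIV"
      using A FE by (simp add: extension_def)
  qed
  moreover have "ran (extension \<mu>) \<subseteq> B"
    using part extension_value_has_sum(2)[OF pm]
    by (fastforce simp: ran_def extension_def split: if_splits)
  ultimately show ?thesis
    by (simp add: premeasure_iff)
qed

text \<open>If \<open>C\<close> is in \<open>dom \<nu>\<close>, the members of any partition of
  \<open>C\<close> into \<open>dom \<mu>\<close> lie in both domains, where the two maps agree;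
  additivity of \<open>\<nu>\<close> then gives the sum required by the extension. The case
  \<open>\<nu> = \<mu>\<close> shows that \<open>\<mu>\<close> is extended.\<close>

lemma similar_subset_extension:
  assumes \<mu>: "premeasure (top_of_set B) \<mu>" and \<nu>: "premeasure (top_of_set B) \<nu>"
    and sim: "similar \<nu> \<mu>"
  shows "\<nu> \<subseteq>\<^sub>m extension \<mu>"
proof -
  have pm: "premeasure euclidean \<mu>" "premeasure euclidean \<nu>" and ran: "ran \<nu> \<subseteq> B"
    using \<mu> \<nu> by (auto simp: premeasure_iff)
  have host: "host \<nu> = host \<mu>" and agree: "\<And>A. A \<in> dom \<nu> \<Longrightarrow> A \<in> dom \<mu> \<Longrightarrow> \<nu> A = \<mu> A"
    using sim by (auto simp: similar_def)
  note ideal = premeasure_ideal[OF pm(1)]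
  have ideal': "exhausting_ideal (host \<mu>) (dom \<nu>)"
    using premeasure_ideal[OF pm(2)] host by simp
  have sum: "((\<lambda>i. the (\<mu> (F i))) has_sum the (\<nu> C)) UNIV"
    if "C \<in> dom \<nu>" and F: "partition_into (dom \<mu>) UNIV F C" for C and F :: "nat \<Rightarrow> _"
  proof -
    have Fdom: "F i \<in> dom \<mu>" for i
      using partition_into_mem[OF F] by simp
    moreover have "F i \<in> dom \<nu>" for i
    proof (rule exhausting_ideal_down[OF ideal' that(1)])
      show "F i \<in> host \<mu>"
        using Fdom exhausting_ideal_subset[OF ideal] by blast
      show "F i \<subseteq> C"
        using partition_into_Union[OF F] by blast
    qed
    ultimately have "\<nu> (F i) = \<mu> (F i)" "F i \<in> dom \<nu>" for i
      using agree by auto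
    moreover from this have "partition_into (dom \<nu>) UNIV F C"
      using F unfolding partition_into_def by blast
    ultimately show ?thesis
      using premeasure_euclidean_has_sum[OF pm(2) that(1), of UNIV F] by simp
  qed
  have "\<nu> A = extension \<mu> A" if A: "A \<in> dom \<nu>" for A
  proof -
    have AQ: "A \<in> host \<mu>"
      using A exhausting_ideal_subset[OF ideal'] by blast
    have AE: "A \<in> extension_domain \<mu>"
      unfolding extension_domain_def
    proof (intro CollectI conjI ballI allI impI)
      fix C and F :: "nat \<Rightarrow> _"
      assume C: "C \<in> host \<mu>" "C \<subseteq> A" and F: "partition_into (dom \<mu>) UNIV F C"
      have "C \<in> dom \<nu>"
        by (rule exhausting_ideal_down[OF ideal' A C])
      moreover from this have "the (\<nu> C) \<in> B"
        using ran by (auto simp: ran_def)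
      ultimately show "\<exists>s\<in>B. ((\<lambda>i. the (\<mu> (F i))) has_sum s) UNIV"
        using sum[OF _ F] by blast
    qed (rule AQ)
    obtain F :: "nat \<Rightarrow> _" where F: "partition_into (dom \<mu>) UNIV F A"
      using AQ by (rule exhausting_ideal_partition[OF ideal])
    have "the (\<nu> A) = extension_value \<mu> A"
      using sum[OF A F] extension_value_has_sum(1)[OF pm(1) AE F] by (rule has_sum_unique)
    then show ?thesis
      using A AE by (auto simp: extension_def)
  qed
  then show ?thesis
    by (simp add: map_le_def)
qed

section \<open>Maximality and uniqueness of the associated measure\<close>

lemma valued_measure_extension:
  assumes \<mu>: "premeasure (top_of_set B) \<mu>"
  shows "valued_measure (top_of_set B) (extension \<mu>)" "similar (extension \<mu>) \<mu>" "\<mu> \<subseteq>\<^sub>m extension \<mu>"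
proof -
  show le: "\<mu> \<subseteq>\<^sub>m extension \<mu>"
    using \<mu> by (intro similar_subset_extension) (auto simp: similar_def)
  have host: "host (extension \<mu>) = host \<mu>"
    using \<mu> by (intro host_extension) (auto simp: premeasure_iff)
  with le show "similar (extension \<mu>) \<mu>"
    by (auto simp: similar_def map_le_def)
  show "valued_measure (top_of_set B) (extension \<mu>)"
    unfolding valued_measure_def
  proof (intro conjI allI impI)
    fix \<nu> assume \<nu>: "premeasure (top_of_set B) \<nu> \<and> similar \<nu> (extension \<mu>)"
    \<comment> \<open>The extension agrees with \<open>\<mu>\<close> on \<open>dom \<mu>\<close>, so
      similarity to the extension passes to similarity to \<open>\<mu>\<close>.\<close>
    have "\<nu> A = \<mu> A" if "A \<in> dom \<nu>" "A \<in> dom \<mu>" for A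
    proof -
      have "A \<in> dom (extension \<mu>)" "extension \<mu> A = \<mu> A"
        using le that by (auto simp: map_le_def dom_def)
      then show ?thesis
        using \<nu> that by (auto simp: similar_def)
    qed
    then have "similar \<nu> \<mu>"
      using \<nu> host by (simp add: similar_def)
    then show "\<nu> \<subseteq>\<^sub>m extension \<mu>"
      using \<mu> \<nu> by (intro similar_subset_extension) auto
  qed (rule premeasure_extension[OF \<mu>])
qed

text \<open>Agreement spreads from \<open>E\<close> to the common domain, so the measures are
  similar, and maximality makes each an extension of the other.\<close>

lemma valued_measure_eqI:
  assumes \<mu>: "valued_measure (top_of_set B) \<mu>" "host \<mu> = \<Q>"
    and \<nu>: "valued_measure (top_of_set B) \<nu>" "host \<nu> = \<Q>"
    and E: "exhausting_ideal \<Q> E" "E \<subseteq> dom \<mu> \<inter> dom \<nu>" "\<And>A. A \<in> E \<Longrightarrow> \<mu> A = \<nu> A"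
  shows "\<mu> = \<nu>"
proof -
  have pm: "premeasure euclidean \<mu>" "premeasure euclidean \<nu>"
    using \<mu> \<nu> by (auto simp: valued_measure_def premeasure_iff)
  have "\<mu> A = \<nu> A" if "A \<in> dom \<mu> \<inter> dom \<nu>" for A
    using premeasures_agree[OF pm(1) \<mu>(2) pm(2) E that] .
  then have "similar \<mu> \<nu>" "similar \<nu> \<mu>"
    using \<mu> \<nu> by (auto simp: similar_def)
  then show ?thesis
    using \<mu> \<nu> by (intro map_le_antisym) (auto simp: valued_measure_def)
qed

text \<open>Resolves the \<open>THE\<close> in \<open>assoc_measure\<close>: a similar measure
  extends \<open>\<mu>\<close> by maximality, hence agrees with the extension on the exhausting
  ideal \<open>dom \<mu>\<close>.\<close>

lemma assoc_measure_eq_extension: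
  assumes \<mu>: "premeasure (top_of_set B) \<mu>"
  shows "assoc_measure (top_of_set B) \<mu> = extension \<mu>"
  unfolding assoc_measure_def
proof (rule the_equality)
  note ext = valued_measure_extension[OF \<mu>]
  show "valued_measure (top_of_set B) (extension \<mu>) \<and> similar (extension \<mu>) \<mu>"
    using ext by simp
  fix \<nu> assume \<nu>: "valued_measure (top_of_set B) \<nu> \<and> similar \<nu> \<mu>"
  then have "similar \<mu> \<nu>"
    by (auto simp: similar_def)
  then have le: "\<mu> \<subseteq>\<^sub>m \<nu>"
    using \<mu> \<nu> by (simp add: valued_measure_def)
  show "\<nu> = extension \<mu>"
  proof (rule valued_measure_eqI)
    show "exhausting_ideal (host \<mu>) (dom \<mu>)"
      using \<mu> by (rule premeasure_ideal)
    show "dom \<mu> \<subseteq> dom \<nu> \<inter> dom (extension \<mu>)"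
      using le ext(3) by (simp add: map_le_implies_dom_le)
    show "\<nu> A = extension \<mu> A" if "A \<in> dom \<mu>" for A
      using le ext(3) that by (simp add: map_le_def)
  qed (use \<nu> ext in \<open>auto simp: similar_def\<close>)
qed

lemma assoc_measure:
  assumes "premeasure (top_of_set B) \<mu>"
  shows "valued_measure (top_of_set B) (assoc_measure (top_of_set B) \<mu>)"
    and "host (assoc_measure (top_of_set B) \<mu>) = host \<mu>"
    and "\<mu> \<subseteq>\<^sub>m assoc_measure (top_of_set B) \<mu>"
  using valued_measure_extension[OF assms]
  by (auto simp: assoc_measure_eq_extension[OF assms] similar_def)

section \<open>Pointwise sums, and values in a sequentially closed set\<close>

lemma premeasure_pointwise_sum:
  assumes \<mu>: "premeasure (top_of_set B) \<mu>" "host \<mu> = \<Q>"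
    and \<nu>: "premeasure (top_of_set B) \<nu>" "host \<nu> = \<Q>"
  shows "premeasure (top_of_set B) (pointwise_sum \<mu> \<nu>)" and "host (pointwise_sum \<mu> \<nu>) = \<Q>"
proof -
  have pm: "premeasure euclidean \<mu>" "premeasure euclidean \<nu>" and ran: "ran \<mu> \<subseteq> B" "ran \<nu> \<subseteq> B"
    using \<mu> \<nu> by (auto simp: premeasure_iff)
  have Q: "sigma_ring \<Q>"
    using host_sigma_ring \<mu>(2) by blast
  have ideal: "exhausting_ideal \<Q> (dom \<mu> \<inter> dom \<nu>)"
    using premeasure_ideal[OF \<mu>(1)] premeasure_ideal[OF \<nu>(1)] \<mu>(2) \<nu>(2)
    by (intro exhausting_ideal_Int[OF Q]) simp_all
  show "host (pointwise_sum \<mu> \<nu>) = \<Q>"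
    unfolding host_def dom_pointwise_sum by (rule exhausting_ideal_imp_hull[OF Q ideal])
  have val: "the (pointwise_sum \<mu> \<nu> A) = the (\<mu> A) + the (\<nu> A)" if "A \<in> dom \<mu> \<inter> dom \<nu>" for A
    using that by (simp only: pointwise_sum_def if_True option.sel)
  have "premeasure euclidean (pointwise_sum \<mu> \<nu>)"
  proof (rule premeasure_euclideanI)
    show "delta_ring (dom (pointwise_sum \<mu> \<nu>))"
      unfolding dom_pointwise_sum by (rule exhausting_ideal_imp_delta_ring[OF Q ideal])
    show "the (pointwise_sum \<mu> \<nu> {}) = 0"
      using val[OF exhausting_ideal_empty[OF ideal]] pm by (simp add: premeasure_empty)
    fix A and F :: "nat \<Rightarrow> _"
    assume "A \<in> dom (pointwise_sum \<mu> \<nu>)" "partition_into (dom (pointwise_sum \<mu> \<nu>)) UNIV F A"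
    then have A: "A \<in> dom \<mu> \<inter> dom \<nu>" and F: "partition_into (dom \<mu> \<inter> dom \<nu>) UNIV F A"
      unfolding dom_pointwise_sum by auto
    have "((\<lambda>i. the (\<mu> (F i)) + the (\<nu> (F i))) has_sum the (\<mu> A) + the (\<nu> A)) UNIV"
      using A by (intro has_sum_add premeasure_euclidean_has_sum pm partition_into_mono[OF F]) auto
    then show "((\<lambda>i. the (pointwise_sum \<mu> \<nu> (F i))) has_sum the (pointwise_sum \<mu> \<nu> A)) UNIV"
      using val[OF A] val[OF partition_into_mem[OF F UNIV_I]] by simp
  qed
  moreover have "ran (pointwise_sum \<mu> \<nu>) \<subseteq> B"
    using ran by (auto simp: ran_def pointwise_sum_def subset_iff split: if_splits intro!: add_mem)
  ultimately show "premeasure (top_of_set B) (pointwise_sum \<mu> \<nu>)"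
    by (simp add: premeasure_iff)
qed

text \<open>Sequential closedness enters here: each value is the limit of the partial sums of a series in \<open>B\<close>.\<close>

lemma valued_measure_euclidean:
  assumes \<mu>: "valued_measure (top_of_set B) \<mu>" and B: "seq_closed B"
  shows "valued_measure euclidean \<mu>"
  unfolding valued_measure_def
proof (intro conjI allI impI)
  have pmB: "premeasure (top_of_set B) \<mu>"
    using \<mu> by (simp add: valued_measure_def)
  then show pm: "premeasure euclidean \<mu>"
    by (simp add: premeasure_iff)
  have ran: "ran \<mu> \<subseteq> B"
    using pmB by (simp add: premeasure_iff)
  fix \<nu> assume "premeasure euclidean \<nu> \<and> similar \<nu> \<mu>"
  then have \<nu>: "premeasure euclidean \<nu>" and sim: "similar \<nu> \<mu>" by auto
  have host: "host \<nu> = host \<mu>"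
    using sim by (simp add: similar_def)
  \<comment> \<open>On this ideal \<open>\<nu>\<close> takes the values of \<open>\<mu>\<close>,
    which lie in \<open>B\<close>; partitioning into it exhibits every value of \<open>\<nu>\<close>
    as the sum of a series in \<open>B\<close>.\<close>
  have ideal: "exhausting_ideal (host \<nu>) (dom \<nu> \<inter> dom \<mu>)"
    using exhausting_ideal_Int[OF host_sigma_ring premeasure_ideal[OF \<nu>]] premeasure_ideal[OF pm] host
    by simp
  have "the (\<nu> A) \<in> B" if A: "A \<in> dom \<nu>" for A
  proof -
    have "A \<in> host \<nu>"
      using A exhausting_ideal_subset[OF premeasure_ideal[OF \<nu>]] by blast
    then obtain F :: "nat \<Rightarrow> _" where F: "partition_into (dom \<nu> \<inter> dom \<mu>) UNIV F A"
      by (rule exhausting_ideal_partition[OF ideal])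
    have "((\<lambda>i. the (\<nu> (F i))) has_sum the (\<nu> A)) UNIV"
      by (intro premeasure_euclidean_has_sum[OF \<nu> A] partition_into_mono[OF F]) auto
    \<comment> \<open>The unordered sum is weakened to convergence of the initial partial sums, the
      form to which sequential closedness applies.\<close>
    then have lim: "(\<lambda>n. \<Sum>i<n. the (\<nu> (F i))) \<longlonglongrightarrow> the (\<nu> A)"
      using has_sum_imp_sums sums_def by blast
    have "the (\<nu> (F i)) \<in> B" for i
    proof -
      have Fi: "F i \<in> dom \<nu> \<inter> dom \<mu>"
        using partition_into_mem[OF F] by blast
      then have "\<nu> (F i) = \<mu> (F i)"
        using sim by (auto simp: similar_def)
      with Fi show ?thesis
        using ran by (auto simp: ran_def)
    qed
    then have "(\<Sum>i<n. the (\<nu> (F i))) \<in> B" for n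
      by (auto intro: sum_mem)
    then show ?thesis
      using lim by (rule seq_closedD[OF B])
  qed
  then have "ran \<nu> \<subseteq> B"
    by (force simp: ran_def dom_def)
  then have "premeasure (top_of_set B) \<nu>"
    using \<nu> by (simp add: premeasure_iff)
  then show "\<nu> \<subseteq>\<^sub>m \<mu>"
    using \<mu> sim by (simp add: valued_measure_def)
qed

end

section \<open>The vector space of measures\<close>

context topological_vector_space
begin

lemma tendsto_scale: "smul k \<midarrow>x\<rightarrow> smul k x"
proof -
  have "continuous_on UNIV ((\<lambda>(k, x). smul k x) \<circ> Pair k)"
    by (intro continuous_on_compose continuous_intros continuous_on_subset[OF continuous_on_scale]) auto
  then have "continuous_on UNIV (smul k)"
    by (simp add: o_def)
  then show ?thesis
    by (simp add: continuous_on_def)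
qed

lemma has_sum_scale:
  assumes "(f has_sum s) I"
  shows "((\<lambda>i. smul k (f i)) has_sum smul k s) I"
  using has_sum_comm_additive_general[OF _ tendsto_scale assms, of k]
  by (simp add: o_def scale_sum_right)

end

lemma dom_pointwise_scale: "dom (pointwise_scale smul k \<mu>) = dom \<mu>"
  by (auto simp: pointwise_scale_def)

lemma host_pointwise_scale: "host (pointwise_scale smul k \<mu>) = host \<mu>"
  by (simp add: host_def dom_pointwise_scale)

section \<open>The scalars as a field in record form\<close>

lemma cring_field_record: "cring (field_record :: 'k::field ring)"
proof (rule cringI)
  have "\<exists>y. y + x = 0" for x :: 'k
    by (rule exI[of _ "- x"]) simp
  then show "abelian_group (field_record :: 'k ring)"
    by (intro abelian_groupI) (auto simp: field_record_def algebra_simps)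
qed (auto intro!: comm_monoidI simp: field_record_def algebra_simps)

lemma field_field_record: "Ring.field (field_record :: 'k::field ring)"
proof (rule cring.cring_fieldI2[OF cring_field_record])
  show "\<zero>\<^bsub>field_record :: 'k ring\<^esub> \<noteq> \<one>\<^bsub>field_record\<^esub>"
    by (simp add: field_record_def)
  show "\<exists>b\<in>carrier field_record. a \<otimes>\<^bsub>field_record\<^esub> b = \<one>\<^bsub>field_record\<^esub>"
    if "a \<in> carrier field_record" "a \<noteq> \<zero>\<^bsub>field_record\<^esub>" for a :: 'k
    using that by (intro bexI[of _ "inverse a"]) (auto simp: field_record_def)
qed

text \<open>Abstracting \<open>B\<close> to a set closed under the operations lets the module laws
  be proved once and instantiated for the whole space and for a subspace.\<close>

locale measure_vector_space =
  topological_vector_space smul + value_monoid B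
  for smul :: "'k::topological_field \<Rightarrow> 'a::{topological_ab_group_add, t2_space} \<Rightarrow> 'a" and B :: "'a set" +
  fixes \<Q> :: "'x set set"
  assumes sigma_ring: "sigma_ring \<Q>"
    and scale_mem: "x \<in> B \<Longrightarrow> smul k x \<in> B"
begin

abbreviation M where "M \<equiv> measure_space_over smul \<Q> (top_of_set B)"

lemma carrier_M: "\<mu> \<in> carrier M \<longleftrightarrow> valued_measure (top_of_set B) \<mu> \<and> host \<mu> = \<Q>"
  by (simp add: measure_space_over_def)

lemma carrier_premeasure: "\<mu> \<in> carrier M \<Longrightarrow> premeasure (top_of_set B) \<mu>"
  by (simp add: carrier_M valued_measure_def)

lemma carrier_ideal: "\<mu> \<in> carrier M \<Longrightarrow> exhausting_ideal \<Q> (dom \<mu>)"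
  using premeasure_ideal[OF carrier_premeasure] by (fastforce simp: carrier_M)

lemma premeasure_pointwise_scale:
  assumes "premeasure (top_of_set B) \<mu>"
  shows "premeasure (top_of_set B) (pointwise_scale smul k \<mu>)"
proof -
  have pm: "premeasure euclidean \<mu>" and ran: "ran \<mu> \<subseteq> B"
    using assms by (auto simp: premeasure_iff)
  have val: "the (pointwise_scale smul k \<mu> A) = smul k (the (\<mu> A))" if "A \<in> dom \<mu>" for A
    using that by (auto simp: pointwise_scale_def)
  have "premeasure euclidean (pointwise_scale smul k \<mu>)"
  proof (rule premeasure_euclideanI, unfold dom_pointwise_scale)
    show "delta_ring (dom \<mu>)"
      using pm by (simp add: premeasure_def)
    show "the (pointwise_scale smul k \<mu> {}) = 0"
      using val[OF exhausting_ideal_empty[OF premeasure_ideal[OF pm]]] pm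
      by (simp add: premeasure_empty)
    fix A and F :: "nat \<Rightarrow> _"
    assume A: "A \<in> dom \<mu>" and F: "partition_into (dom \<mu>) UNIV F A"
    then have "((\<lambda>i. smul k (the (\<mu> (F i)))) has_sum smul k (the (\<mu> A))) UNIV"
      by (intro has_sum_scale premeasure_euclidean_has_sum[OF pm])
    then show "((\<lambda>i. the (pointwise_scale smul k \<mu> (F i))) has_sum the (pointwise_scale smul k \<mu> A)) UNIV"
      using val[OF A] val[OF partition_into_mem[OF F UNIV_I]] by simp
  qed
  moreover have "ran (pointwise_scale smul k \<mu>) \<subseteq> B"
    using ran scale_mem by (auto simp: ran_def pointwise_scale_def)
  ultimately show ?thesis
    by (simp add: premeasure_iff)
qed

lemma add_M:
  assumes "\<mu> \<in> carrier M" "\<nu> \<in> carrier M"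
  shows "\<mu> \<oplus>\<^bsub>M\<^esub> \<nu> \<in> carrier M" and "pointwise_sum \<mu> \<nu> \<subseteq>\<^sub>m \<mu> \<oplus>\<^bsub>M\<^esub> \<nu>"
proof -
  have pm: "premeasure (top_of_set B) (pointwise_sum \<mu> \<nu>)" "host (pointwise_sum \<mu> \<nu>) = \<Q>"
    using assms by (intro premeasure_pointwise_sum carrier_premeasure; simp add: carrier_M)+
  have add: "\<mu> \<oplus>\<^bsub>M\<^esub> \<nu> = assoc_measure (top_of_set B) (pointwise_sum \<mu> \<nu>)"
    by (simp add: measure_space_over_def)
  show "\<mu> \<oplus>\<^bsub>M\<^esub> \<nu> \<in> carrier M" "pointwise_sum \<mu> \<nu> \<subseteq>\<^sub>m \<mu> \<oplus>\<^bsub>M\<^esub> \<nu>"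
    using assoc_measure[OF pm(1)] pm(2) by (auto simp: carrier_M add)
qed

text \<open>Since the associated measure extends the pointwise sum, addition is pointwise where both
  summands are defined; the vector space laws thus become identities between vectors.\<close>

lemma add_M_apply:
  assumes "\<mu> \<in> carrier M" "\<nu> \<in> carrier M" "\<mu> A = Some a" "\<nu> A = Some b"
  shows "(\<mu> \<oplus>\<^bsub>M\<^esub> \<nu>) A = Some (a + b)"
proof -
  have "pointwise_sum \<mu> \<nu> A = Some (a + b)"
    using assms by (auto simp: pointwise_sum_def)
  then show ?thesis
    using add_M(2)[OF assms(1,2)] unfolding map_le_def by (metis domI)
qed

lemma smult_M:
  assumes "\<mu> \<in> carrier M"
  shows "k \<odot>\<^bsub>M\<^esub> \<mu> \<in> carrier M" and "pointwise_scale smul k \<mu> \<subseteq>\<^sub>m k \<odot>\<^bsub>M\<^esub> \<mu>"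
proof -
  have pm: "premeasure (top_of_set B) (pointwise_scale smul k \<mu>)"
    using assms by (intro premeasure_pointwise_scale carrier_premeasure)
  have smult: "k \<odot>\<^bsub>M\<^esub> \<mu> = assoc_measure (top_of_set B) (pointwise_scale smul k \<mu>)"
    by (simp add: measure_space_over_def)
  show "k \<odot>\<^bsub>M\<^esub> \<mu> \<in> carrier M" "pointwise_scale smul k \<mu> \<subseteq>\<^sub>m k \<odot>\<^bsub>M\<^esub> \<mu>"
    using assoc_measure[OF pm] assms by (auto simp: carrier_M smult host_pointwise_scale)
qed

lemma smult_M_apply:
  assumes "\<mu> \<in> carrier M" "\<mu> A = Some a"
  shows "(k \<odot>\<^bsub>M\<^esub> \<mu>) A = Some (smul k a)"
proof -
  have "pointwise_scale smul k \<mu> A = Some (smul k a)"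
    using assms by (auto simp: pointwise_scale_def)
  then show ?thesis
    using smult_M(2)[OF assms(1)] unfolding map_le_def by (metis domI)
qed

lemma zero_M_apply: "A \<in> \<Q> \<Longrightarrow> \<zero>\<^bsub>M\<^esub> A = Some 0"
  by (simp add: measure_space_over_def)

text \<open>A domain is always contained in its host, so a map similar to one defined on all of
  \<open>\<Q>\<close> has no room for a larger domain, and maximality is automatic.\<close>

lemma zero_M_closed: "\<zero>\<^bsub>M\<^esub> \<in> carrier M"
proof -
  have dom: "dom \<zero>\<^bsub>M\<^esub> = \<Q>"
    by (auto simp: measure_space_over_def split: if_splits)
  have host: "host \<zero>\<^bsub>M\<^esub> = \<Q>"
    using sigma_ring by (simp add: host_def dom hull_same)
  have "premeasure euclidean \<zero>\<^bsub>M\<^esub>"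
  proof (rule premeasure_euclideanI, unfold dom)
    show "delta_ring \<Q>"
      using sigma_ring by (rule sigma_ring_imp_delta_ring)
    show "the (\<zero>\<^bsub>M\<^esub> {}) = 0"
      using exhausting_ideal_empty[OF exhausting_ideal_self[OF sigma_ring]] zero_M_apply by simp
    fix A and F :: "nat \<Rightarrow> _"
    assume "A \<in> \<Q>" "partition_into \<Q> UNIV F A"
    then show "((\<lambda>i. the (\<zero>\<^bsub>M\<^esub> (F i))) has_sum the (\<zero>\<^bsub>M\<^esub> A)) UNIV"
      using zero_M_apply partition_into_mem[of \<Q> UNIV F A] by simp
  qed
  moreover have "ran \<zero>\<^bsub>M\<^esub> \<subseteq> B"
    using zero_mem by (auto simp: ran_def measure_space_over_def split: if_splits)
  ultimately have pm: "premeasure (top_of_set B) \<zero>\<^bsub>M\<^esub>"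
    by (simp add: premeasure_iff)
  have "\<nu> \<subseteq>\<^sub>m \<zero>\<^bsub>M\<^esub>" if "similar \<nu> \<zero>\<^bsub>M\<^esub>" for \<nu>
  proof -
    have "dom \<nu> \<subseteq> \<Q>"
      using that host hull_subset[of "dom \<nu>" sigma_ring] by (auto simp: similar_def host_def)
    then show ?thesis
      using that dom unfolding similar_def map_le_def by blast
  qed
  with pm host show ?thesis
    by (simp add: carrier_M valued_measure_def)
qed

text \<open>The common value \<open>Some a\<close> records definedness and equality at once, so
  evaluating both sides on \<open>E\<close> settles both.\<close>

lemma carrier_M_eqI:
  assumes "\<mu> \<in> carrier M" "\<nu> \<in> carrier M" "exhausting_ideal \<Q> E"
    and "\<And>A. A \<in> E \<Longrightarrow> \<exists>a. \<mu> A = Some a \<and> \<nu> A = Some a"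
  shows "\<mu> = \<nu>"
  using assms by (intro valued_measure_eqI[of \<mu> \<Q> \<nu> E]) (auto simp: carrier_M dom_def; fastforce)+

lemma abelian_group_M: "abelian_group M"
proof (rule abelian_groupI)
  fix x y z assume x: "x \<in> carrier M" and y: "y \<in> carrier M" and z: "z \<in> carrier M"
  show "x \<oplus>\<^bsub>M\<^esub> y \<oplus>\<^bsub>M\<^esub> z = x \<oplus>\<^bsub>M\<^esub> (y \<oplus>\<^bsub>M\<^esub> z)"
  proof (rule carrier_M_eqI[of _ _ "dom x \<inter> dom y \<inter> dom z"])
    show "exhausting_ideal \<Q> (dom x \<inter> dom y \<inter> dom z)"
      using x y z by (intro exhausting_ideal_Int[OF sigma_ring] carrier_ideal)
    fix A assume "A \<in> dom x \<inter> dom y \<inter> dom z"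
    then obtain a b c where "x A = Some a" "y A = Some b" "z A = Some c" by auto
    then show "\<exists>a. (x \<oplus>\<^bsub>M\<^esub> y \<oplus>\<^bsub>M\<^esub> z) A = Some a \<and> (x \<oplus>\<^bsub>M\<^esub> (y \<oplus>\<^bsub>M\<^esub> z)) A = Some a"
      using x y z by (simp add: add_M_apply add_M(1) add.assoc)
  qed (use x y z in \<open>auto intro: add_M(1)\<close>)
next
  fix x y assume x: "x \<in> carrier M" and y: "y \<in> carrier M"
  show "x \<oplus>\<^bsub>M\<^esub> y = y \<oplus>\<^bsub>M\<^esub> x"
  proof (rule carrier_M_eqI[of _ _ "dom x \<inter> dom y"])
    show "exhausting_ideal \<Q> (dom x \<inter> dom y)"
      using x y by (intro exhausting_ideal_Int[OF sigma_ring] carrier_ideal)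
    fix A assume "A \<in> dom x \<inter> dom y"
    then obtain a b where "x A = Some a" "y A = Some b" by auto
    then show "\<exists>a. (x \<oplus>\<^bsub>M\<^esub> y) A = Some a \<and> (y \<oplus>\<^bsub>M\<^esub> x) A = Some a"
      using x y by (simp add: add_M_apply add.commute)
  qed (use x y in \<open>auto intro: add_M(1)\<close>)
next
  fix x assume x: "x \<in> carrier M"
  note sub = exhausting_ideal_subset[OF carrier_ideal[OF x]]
  show "\<zero>\<^bsub>M\<^esub> \<oplus>\<^bsub>M\<^esub> x = x"
  proof (rule carrier_M_eqI[OF _ x carrier_ideal[OF x]])
    fix A assume A: "A \<in> dom x"
    then obtain a where "x A = Some a" by auto
    then show "\<exists>a. (\<zero>\<^bsub>M\<^esub> \<oplus>\<^bsub>M\<^esub> x) A = Some a \<and> x A = Some a"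
      using add_M_apply[OF zero_M_closed x zero_M_apply] A sub by auto
  qed (auto intro: add_M(1) x zero_M_closed)
  \<comment> \<open>The additive inverse is the multiple by -1. The sum and the zero measure may
    only be compared pointwise on \<open>dom x\<close> at first.\<close>
  have "((- 1) \<odot>\<^bsub>M\<^esub> x) \<oplus>\<^bsub>M\<^esub> x = \<zero>\<^bsub>M\<^esub>"
  proof (rule carrier_M_eqI[OF _ zero_M_closed carrier_ideal[OF x]])
    fix A assume A: "A \<in> dom x"
    then obtain a where "x A = Some a" by auto
    then show "\<exists>a. (((- 1) \<odot>\<^bsub>M\<^esub> x) \<oplus>\<^bsub>M\<^esub> x) A = Some a \<and> \<zero>\<^bsub>M\<^esub> A = Some a"
      using add_M_apply[OF smult_M(1)[OF x] x smult_M_apply[OF x]] A sub zero_M_apply by auto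
  qed (auto intro: add_M(1) x smult_M(1))
  then show "\<exists>y\<in>carrier M. y \<oplus>\<^bsub>M\<^esub> x = \<zero>\<^bsub>M\<^esub>"
    using smult_M(1)[OF x] by blast
qed (auto intro: add_M(1) zero_M_closed)

lemma module_M: "Module.module field_record M"
proof (rule moduleI[OF cring_field_record abelian_group_M])
  fix a b and x y assume x: "x \<in> carrier M" and y: "y \<in> carrier M"
  show "(a \<oplus>\<^bsub>field_record\<^esub> b) \<odot>\<^bsub>M\<^esub> x = a \<odot>\<^bsub>M\<^esub> x \<oplus>\<^bsub>M\<^esub> b \<odot>\<^bsub>M\<^esub> x"
    by (rule carrier_M_eqI[OF _ _ carrier_ideal[OF x]])
      (auto simp: field_record_def smult_M_apply add_M_apply x smult_M(1) add_M(1) scale_left_distrib)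
  show "(a \<otimes>\<^bsub>field_record\<^esub> b) \<odot>\<^bsub>M\<^esub> x = a \<odot>\<^bsub>M\<^esub> (b \<odot>\<^bsub>M\<^esub> x)"
    by (rule carrier_M_eqI[OF _ _ carrier_ideal[OF x]])
      (auto simp: field_record_def smult_M_apply x smult_M(1) intro: smult_M(1))
  show "\<one>\<^bsub>field_record\<^esub> \<odot>\<^bsub>M\<^esub> x = x"
    by (rule carrier_M_eqI[OF _ _ carrier_ideal[OF x]])
      (auto simp: field_record_def smult_M_apply x intro: smult_M(1))
  show "a \<odot>\<^bsub>M\<^esub> (x \<oplus>\<^bsub>M\<^esub> y) = a \<odot>\<^bsub>M\<^esub> x \<oplus>\<^bsub>M\<^esub> a \<odot>\<^bsub>M\<^esub> y"
    by (rule carrier_M_eqI[OF _ _ exhausting_ideal_Int[OF sigma_ring carrier_ideal[OF x] carrier_ideal[OF y]]])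
      (auto simp: smult_M_apply add_M_apply x y smult_M(1) add_M(1) scale_right_distrib)
qed (auto intro: smult_M(1))

lemma vector_space_over_M: "vector_space_over field_record M"
  by (simp add: vector_space_over_def field_field_record module_M)

lemma smult_M_nonzero:
  assumes k: "k \<noteq> 0" and \<mu>: "\<mu> \<in> carrier M"
  shows "k \<odot>\<^bsub>M\<^esub> \<mu> = pointwise_scale smul k \<mu>"
proof -
  have inv: "pointwise_scale smul c (pointwise_scale smul d \<nu>) = \<nu>" if "c * d = 1" for c d and \<nu> :: "'x set \<rightharpoonup> 'a"
    using that by (auto simp: pointwise_scale_def fun_eq_iff option.map_comp o_def option.map_ident)
  have "k \<odot>\<^bsub>M\<^esub> \<mu> \<subseteq>\<^sub>m pointwise_scale smul k \<mu>"
  proof -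
    \<comment> \<open>Scaling \<open>k \<odot> \<mu>\<close> back by \<open>inverse k\<close> gives
      a premeasure similar to \<open>\<mu>\<close>, so maximality of \<open>\<mu>\<close> bounds its
      domain; scaling by \<open>k\<close> again gives the reverse inclusion.\<close>
    let ?\<nu> = "pointwise_scale smul (inverse k) (k \<odot>\<^bsub>M\<^esub> \<mu>)"
    have "premeasure (top_of_set B) ?\<nu>"
      by (intro premeasure_pointwise_scale carrier_premeasure smult_M(1) \<mu>)
    moreover have "similar ?\<nu> \<mu>"
    proof -
      have "?\<nu> A = \<mu> A" if "A \<in> dom \<mu>" for A
        using that k smult_M_apply[OF \<mu>] by (auto simp: pointwise_scale_def)
      then show ?thesis
        using \<mu> smult_M(1)[OF \<mu>, of k] by (auto simp: similar_def host_pointwise_scale carrier_M)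
    qed
    ultimately have le: "?\<nu> \<subseteq>\<^sub>m \<mu>"
      using \<mu> by (simp add: carrier_M valued_measure_def)
    have "pointwise_scale smul k ?\<nu> \<subseteq>\<^sub>m pointwise_scale smul k \<mu>"
      using le unfolding map_le_def dom_pointwise_scale by (auto simp: pointwise_scale_def)
    then show ?thesis
      using k inv[of k "inverse k"] by simp
  qed
  then show ?thesis
    using smult_M(2)[OF \<mu>] by (rule map_le_antisym)
qed

end

theorem corollary7p11:
  fixes \<Q> :: "'x set set"
    and smul :: "'k::topological_field \<Rightarrow> 'a::{topological_ab_group_add, t2_space} \<Rightarrow> 'a"
  assumes "sigma_ring \<Q>"
    and "topological_vector_space smul"
  shows "vector_space_over field_record (measure_space_over smul \<Q> euclidean) \<and>
    (\<forall>k. k \<noteq> 0 \<longrightarrow> (\<forall>\<mu>\<in>carrier (measure_space_over smul \<Q> euclidean).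
       k \<odot>\<^bsub>measure_space_over smul \<Q> euclidean\<^esub> \<mu> = pointwise_scale smul k \<mu>)) \<and>
    (\<forall>B. module.subspace smul B \<and> seq_closed B \<longrightarrow>
       vector_subspace_of field_record
         (measure_space_over smul \<Q> (top_of_set B)) (measure_space_over smul \<Q> euclidean))"
proof -
  interpret topological_vector_space smul by fact
  interpret A: measure_vector_space smul UNIV \<Q>
    by unfold_locales (use assms in auto)
  \<comment> \<open>The full space enters as the instance \<open>B = UNIV\<close>, so its facts are
    transferred by rewriting \<open>top_of_set UNIV\<close> to \<open>euclidean\<close>.\<close>
  have top_UNIV: "top_of_set UNIV = (euclidean :: 'a topology)"
    by simp
  note A_space = A.vector_space_over_M[unfolded top_UNIV]
  have "vector_subspace_of field_record
      (measure_space_over smul \<Q> (top_of_set B)) (measure_space_over smul \<Q> euclidean)"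
    (is "vector_subspace_of _ ?W ?V")
    if sub: "subspace B" and closed: "seq_closed B" for B
  proof -
    interpret B: measure_vector_space smul B \<Q>
      by unfold_locales (use assms sub in \<open>auto simp: subspace_def\<close>)
    \<comment> \<open>This is the use of sequential closedness: a measure that is maximal among
      \<open>B\<close>-valued premeasures is maximal among all.\<close>
    have incl: "\<mu> \<in> carrier ?V" if "\<mu> \<in> carrier ?W" for \<mu>
      using that B.valued_measure_euclidean[OF _ closed] B.carrier_M
        A.carrier_M[unfolded top_UNIV] by blast
    have zero: "\<zero>\<^bsub>?W\<^esub> = \<zero>\<^bsub>?V\<^esub>"
      by (simp add: measure_space_over_def)
    \<comment> \<open>The two sums are associated measures for different value spaces, but both
      extend the same pointwise sum and both lie in \<open>?V\<close>.\<close>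
    have add: "x \<oplus>\<^bsub>?W\<^esub> y = x \<oplus>\<^bsub>?V\<^esub> y" if "x \<in> carrier ?W" "y \<in> carrier ?W" for x y
    proof (rule A.carrier_M_eqI[unfolded top_UNIV])
      show "exhausting_ideal \<Q> (dom x \<inter> dom y)"
        using that by (intro exhausting_ideal_Int assms(1) B.carrier_ideal)
      show "\<exists>a. (x \<oplus>\<^bsub>?W\<^esub> y) A = Some a \<and> (x \<oplus>\<^bsub>?V\<^esub> y) A = Some a" if "A \<in> dom x \<inter> dom y" for A
        using that B.add_M_apply A.add_M_apply[unfolded top_UNIV] incl
          \<open>x \<in> carrier ?W\<close> \<open>y \<in> carrier ?W\<close> by fastforce
    qed (use that in \<open>auto intro: incl B.add_M(1) A.add_M(1)[unfolded top_UNIV]\<close>)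
    have smult: "k \<odot>\<^bsub>?W\<^esub> x = k \<odot>\<^bsub>?V\<^esub> x" if "x \<in> carrier ?W" for k x
    proof (rule A.carrier_M_eqI[unfolded top_UNIV])
      show "exhausting_ideal \<Q> (dom x)"
        using that by (rule B.carrier_ideal)
      show "\<exists>a. (k \<odot>\<^bsub>?W\<^esub> x) A = Some a \<and> (k \<odot>\<^bsub>?V\<^esub> x) A = Some a" if "A \<in> dom x" for A
        using that B.smult_M_apply A.smult_M_apply[unfolded top_UNIV] incl
          \<open>x \<in> carrier ?W\<close> by fastforce
    qed (use that in \<open>auto intro: incl B.smult_M(1) A.smult_M(1)[unfolded top_UNIV]\<close>)
    have "submodule (carrier ?W) field_record ?V"
    proof (rule module.submoduleI[OF A.module_M[unfolded top_UNIV]])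
      show "carrier ?W \<subseteq> carrier ?V"
        using incl by blast
      show "\<zero>\<^bsub>?V\<^esub> \<in> carrier ?W"
        using B.zero_M_closed zero by simp
      show "x \<oplus>\<^bsub>?V\<^esub> y \<in> carrier ?W" if "x \<in> carrier ?W" "y \<in> carrier ?W" for x y
        using B.add_M(1)[OF that] add[OF that] by simp
      show "k \<odot>\<^bsub>?V\<^esub> x \<in> carrier ?W" if "x \<in> carrier ?W" for k x
        using B.smult_M(1)[OF that] smult[OF that] by simp
      \<comment> \<open>The negative formed in \<open>?W\<close> is also an inverse in
        \<open>?V\<close>, so uniqueness of inverses identifies the two.\<close>
      show "\<ominus>\<^bsub>?V\<^esub> x \<in> carrier ?W" if x: "x \<in> carrier ?W" for x
      proof -
        have inv: "\<ominus>\<^bsub>?W\<^esub> x \<in> carrier ?W" "\<ominus>\<^bsub>?W\<^esub> x \<oplus>\<^bsub>?W\<^esub> x = \<zero>\<^bsub>?W\<^esub>"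
          using abelian_group.a_inv_closed[OF B.abelian_group_M x]
            abelian_group.l_neg[OF B.abelian_group_M x] by auto
        then have "\<ominus>\<^bsub>?V\<^esub> x = \<ominus>\<^bsub>?W\<^esub> x"
          using abelian_group.minus_equality[OF A.abelian_group_M[unfolded top_UNIV]] incl x
            add[OF inv(1) x] zero by simp
        with inv show ?thesis by simp
      qed
    qed
    then show ?thesis
      unfolding vector_subspace_of_def
      using A_space B.vector_space_over_M zero add smult by simp
  qed
  then show ?thesis
    using A_space A.smult_M_nonzero[unfolded top_UNIV] by blast
qed

end
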